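(* Let $V$ be a real separable Hilbert space and let $a,b,m$ be symmetric bilinear forms on $V$ such that $a$ is continuous and $V$-coercive, $b$ is weakly continuous, and $m$ is weakly continuous with $m(u,u)>0$ for all nonzero $u\in V$. Let $(\lambda_*,\mu_* )$ be a simple eigenpoint of $(a,b,m)$ with corresponding eigenvector $e_*$. If $\mu_n(\lambda_* )=\mu_*$, then the eigencurve $\mu_n(\lambda)$ is differentiable at $\lambda_*$ with $$\left.\frac{d\mu_n}{d\lambda}\right|_{\lambda_*}=-\frac{b(e_*,e_* )}{m(e_*,e_* )}.$$
   Context: "$a$ is continuous and $V$-coercive" means there are constants $0<\kappa_1\le\kappa_2<\infty$ with $\kappa_1\|u\|^2\le a(u,u)\le\kappa_2\|u\|^2$ for all $u\in V$. A symmetric bilinear form $b$ on $V$ is weakly continuous if $u_j\rightharpoonup u$ and $v_j\rightharpoonup v$ weakly in $V$ imply $b(u_j,v_j)\to b(u,v)$. A pair $(\lambda,\mu)\in\mathbb{R}^2$ is an eigenpoint of $(a,b,m)$ if there is a nonzero $u\in V$ (an eigenvector corresponding to $(\lambda,\mu)$) with $a(u,v)=\lambda\,b(u,v)+\mu\,m(u,v)$ for all $v\in V$; it is simple if the space of all such $u$ (with $0$) is one-dimensional. For $\lambda\in\mathbb{R}$ and $n\in\mathbb{N}$ (with $n\le\dim V$ if $V$ is finite dimensional), $\mu_n(\lambda)$ is the $n$-th smallest, counted with multiplicity, of the real numbers $\mu$ for which $(\lambda,\mu)$ is an eigenpoint; equivalently $\mu_n(\lambda)=\inf_{Z_n}\sup_{0\ne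 v\in Z_n}\frac{a(v,v)-\lambda b(v,v)}{m(v,v)}$ over $n$-dimensional subspaces $Z_n$ of $V$. *)

theory Defs
  imports "HOL-Analysis.Analysis"
begin

definition symmetric_bilinear :: "('a::real_vector \<Rightarrow> 'a \<Rightarrow> real) \<Rightarrow> bool" where
  "symmetric_bilinear f \<longleftrightarrow> bilinear f \<and> (\<forall>u v. f u v = f v u)"

definition continuous_coercive :: "('a::real_normed_vector \<Rightarrow> 'a \<Rightarrow> real) \<Rightarrow> bool" where
  "continuous_coercive a \<longleftrightarrow>
     (\<exists>\<kappa>\<^sub>1 \<kappa>\<^sub>2. 0 < \<kappa>\<^sub>1 \<and> \<kappa>\<^sub>1 \<le> \<kappa>\<^sub>2 \<and>
        (\<forall>u. \<kappa>\<^sub>1 * (norm u)\<^sup>2 \<le> a u u \<and> a u u \<le> \<kappa>\<^sub>2 * (norm u)\<^sup>2))"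

definition weakly_converges :: "(nat \<Rightarrow> 'a::real_inner) \<Rightarrow> 'a \<Rightarrow> bool" where
  "weakly_converges x l \<longleftrightarrow> (\<forall>w. (\<lambda>j. inner (x j) w) \<longlonglongrightarrow> inner l w)"

definition weakly_continuous :: "('a::real_inner \<Rightarrow> 'a \<Rightarrow> real) \<Rightarrow> bool" where
  "weakly_continuous f \<longleftrightarrow>
     (\<forall>x y u v. weakly_converges x u \<longrightarrow> weakly_converges y v \<longrightarrow>
        (\<lambda>j. f (x j) (y j)) \<longlonglongrightarrow> f u v)"

definition is_eigenvector ::
    "('a::real_vector \<Rightarrow> 'a \<Rightarrow> real) \<Rightarrow> ('a \<Rightarrow> 'a \<Rightarrow> real) \<Rightarrow> ('a \<Rightarrow> 'a \<Rightarrow> real) \<Rightarrow>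
     real \<Rightarrow> real \<Rightarrow> 'a \<Rightarrow> bool" where
  "is_eigenvector a b m lam mu u \<longleftrightarrow> u \<noteq> 0 \<and> (\<forall>v. a u v = lam * b u v + mu * m u v)"

definition eigenpoint ::
    "('a::real_vector \<Rightarrow> 'a \<Rightarrow> real) \<Rightarrow> ('a \<Rightarrow> 'a \<Rightarrow> real) \<Rightarrow> ('a \<Rightarrow> 'a \<Rightarrow> real) \<Rightarrow>
     real \<Rightarrow> real \<Rightarrow> bool" where
  "eigenpoint a b m lam mu \<longleftrightarrow> (\<exists>u. is_eigenvector a b m lam mu u)"

definition eigenspace ::
    "('a::real_vector \<Rightarrow> 'a \<Rightarrow> real) \<Rightarrow> ('a \<Rightarrow> 'a \<Rightarrow> real) \<Rightarrow> ('a \<Rightarrow> 'a \<Rightarrow> real) \<Rightarrow>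
     real \<Rightarrow> real \<Rightarrow> 'a set" where
  "eigenspace a b m lam mu = insert 0 {u. is_eigenvector a b m lam mu u}"

definition simple_eigenpoint ::
    "('a::real_vector \<Rightarrow> 'a \<Rightarrow> real) \<Rightarrow> ('a \<Rightarrow> 'a \<Rightarrow> real) \<Rightarrow> ('a \<Rightarrow> 'a \<Rightarrow> real) \<Rightarrow>
     real \<Rightarrow> real \<Rightarrow> bool" where
  "simple_eigenpoint a b m lam mu \<longleftrightarrow>
     eigenpoint a b m lam mu \<and> dim (eigenspace a b m lam mu) = 1"

(* The n-th smallest eigenparameter counted with multiplicity is the least one at which
   the number of eigenparameters up to and including it, each counted with the dimension
   of its eigenspace, reaches n.  Numbering starts at n = 1.  An infinite sum or an infinite
   dimension would be counted as 0; if a is coercive, b and m are weakly continuous and m is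
   positive definite, the eigenparameters below any bound are finitely many and have
   finite-dimensional eigenspaces, so neither occurs. *)
definition eigencurve ::
    "('a::real_vector \<Rightarrow> 'a \<Rightarrow> real) \<Rightarrow> ('a \<Rightarrow> 'a \<Rightarrow> real) \<Rightarrow> ('a \<Rightarrow> 'a \<Rightarrow> real) \<Rightarrow>
     nat \<Rightarrow> real \<Rightarrow> real" where
  "eigencurve a b m n lam =
     (LEAST mu. eigenpoint a b m lam mu \<and>
        n \<le> (\<Sum>nu | eigenpoint a b m lam nu \<and> nu \<le> mu. dim (eigenspace a b m lam nu)))"

end

theory Submission
  imports Defs "HOL-Complex_Analysis.Great_Picard"
begin

text \<open>
  Write \<open>Q lam t = a - lam b - t m\<close>, and let \<open>N lam t\<close> be the number of eigenparameters up to \<open>t\<close> at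
  \<open>lam\<close>, counted with multiplicity.  The eigencurve satisfies \<open>\<mu>\<^sub>n(lam) \<le> t\<close> if and only if
  \<open>n \<le> N lam t\<close>, and \<open>N lam t\<close> is the largest dimension of a subspace on which \<open>Q lam t\<close> is
  nonpositive.  Differentiability can therefore be read off from the sign of \<open>Q\<close> near the given
  eigenpoint, without following eigenvectors along the curve.

  At a simple eigenpoint \<open>(lam0, mu0)\<close> on the \<open>n\<close>-th curve, the space splits into \<open>n - 1\<close> dimensions
  on which \<open>Q lam0 mu0\<close> is uniformly negative, the line through \<open>e\<close>, which is its kernel, and a
  complement on which it is coercive (\<open>simple_eigenpoint_splitting\<close>).  Put
  \<open>d = - b e e / m e e\<close>.  For \<open>h\<close> near \<open>0\<close>, the form at the point
  \<open>(lam0 + h, mu0 + h d \<plusminus> \<epsilon> \<bar>h\<bar>)\<close> differs from \<open>Q lam0 mu0\<close> by \<open>- h (b + d m) \<mp> \<epsilon> \<bar>h\<bar> m\<close>.  At \<open>e\<close> the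
  first term vanishes by the choice of \<open>d\<close>, so only the sign of the second one matters there.  On the
  other two parts the unperturbed form wins, and also absorbs the cross terms
  (\<open>perturbed_form_positive\<close>).  Hence \<open>Q\<close> is nonpositive on \<open>n\<close> dimensions at the upper point and
  positive in codimension \<open>n - 1\<close> at the lower point, which traps \<open>\<mu>\<^sub>n(lam0 + h)\<close> between
  \<open>mu0 + h d - \<epsilon> \<bar>h\<bar>\<close> and \<open>mu0 + h d + \<epsilon> \<bar>h\<bar>\<close>.  This is the derivative.

  The description of \<open>N\<close> needs the spectral theory of the pencil at fixed \<open>lam\<close>
  (\<open>spectral_decomposition\<close>).  Its analytic core is that unit vectors on which \<open>Q\<close> is asymptotically
  nonpositive have a nonzero weak limit (\<open>nonzero_weak_limit\<close>): weak sequential compactness gives a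
  limit, and the weak continuity of \<open>b\<close> and \<open>m\<close> against the coercivity of \<open>a\<close> keeps it away from \<open>0\<close>.
  This yields minimisers of Rayleigh quotients, the finiteness of orthogonal families of eigenvectors
  with bounded eigenparameters, and the coercivity of \<open>Q\<close> on their complements.
\<close>

section \<open>Weak sequential compactness of bounded sequences\<close>

lemma linear_coeff_zero_if_quadratic_nonneg:
  fixes x y :: real
  assumes "\<And>t. 0 \<le> 2 * t * x + t\<^sup>2 * y"
  shows "x = 0"
proof (rule ccontr)
  assume "x \<noteq> 0"
  define s where "s = 1 / (\<bar>y\<bar> + 1)"
  have s: "s > 0" "s * \<bar>y\<bar> < 1" by (auto simp: s_def field_simps)
  have "2 * (- s * x) * x + (- s * x)\<^sup>2 * y = s * x\<^sup>2 * (s * y - 2)"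
    by (simp add: power2_eq_square algebra_simps)
  moreover have "s * y < 2"
    using s mult_left_mono[of y "\<bar>y\<bar>" s] by linarith
  ultimately have "2 * (- s * x) * x + (- s * x)\<^sup>2 * y < 0"
    using s \<open>x \<noteq> 0\<close> by (simp add: mult_pos_neg)
  with assms[of "- s * x"] show False by linarith
qed

text \<open>
  The representing vector is the minimiser of \<open>\<parallel>v\<parallel>\<^sup>2 - 2 f v\<close>: the parallelogram law makes every
  minimising sequence Cauchy, and the first-order condition at the minimiser is the claim.
\<close>
theorem riesz_representation:
  fixes f :: "'a::{real_inner, complete_space} \<Rightarrow> real"
  assumes "bounded_linear f"
  obtains x where "\<And>w. f w = inner x w"
proof -
  interpret f: bounded_linear f by fact
  define J where "J v = (norm v)\<^sup>2 - 2 * f v" for v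
  define K where "K = onorm f"
  have "- K\<^sup>2 \<le> J v" for v
  proof -
    have "f v \<le> K * norm v"
      using onorm[OF assms, of v] by (simp add: K_def)
    moreover have "0 \<le> (norm v - K)\<^sup>2" by simp
    ultimately show ?thesis by (simp add: J_def power2_diff algebra_simps)
  qed
  then have bdd: "bdd_below (range J)" by (intro bdd_belowI[of _ "- K\<^sup>2"]) auto
  define d where "d = Inf (range J)"
  have dle: "d \<le> J v" for v
    unfolding d_def by (rule cInf_lower[OF _ bdd]) auto
  have "\<exists>v. J v < d + 1 / Suc j" for j
  proof -
    have "Inf (range J) < d + 1 / Suc j" by (simp add: d_def)
    then show ?thesis using cInf_lessD[of "range J" "d + 1 / Suc j"] by auto
  qed
  then obtain v where v: "\<And>j. J (v j) < d + 1 / Suc j" by metis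
  have par: "(norm (v i - v j))\<^sup>2 \<le> 2 * (1 / Suc i) + 2 * (1 / Suc j)" for i j
  proof -
    define w where "w = (1/2) *\<^sub>R (v i + v j)"
    have "(norm (v i - v j))\<^sup>2 = 2 * J (v i) + 2 * J (v j) - 4 * J w"
      by (simp add: J_def w_def f.scaleR f.add power2_norm_eq_inner inner_simps inner_commute algebra_simps)
    with v[of i] v[of j] dle[of w] show ?thesis by linarith
  qed
  have "Cauchy v"
  proof (rule CauchyI)
    fix \<epsilon> :: real assume "0 < \<epsilon>"
    then have "0 < \<epsilon>\<^sup>2 / 4" by simp
    then obtain M where M: "1 / Suc M < \<epsilon>\<^sup>2 / 4" using nat_approx_posE by blast
    show "\<exists>M. \<forall>i\<ge>M. \<forall>j\<ge>M. norm (v i - v j) < \<epsilon>"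
    proof (intro exI allI impI)
      fix i j assume "M \<le> i" "M \<le> j"
      then have "1 / Suc i \<le> 1 / Suc M" "1 / Suc j \<le> 1 / Suc M"
        by (auto simp: field_simps)
      with par[of i j] M have "(norm (v i - v j))\<^sup>2 < \<epsilon>\<^sup>2" by linarith
      then show "norm (v i - v j) < \<epsilon>" using \<open>0 < \<epsilon>\<close> by (simp add: power2_less_imp_less)
    qed
  qed
  then obtain x where x: "v \<longlonglongrightarrow> x" by (auto simp: Cauchy_convergent_iff convergent_def)
  have "(\<lambda>j. J (v j)) \<longlonglongrightarrow> J x"
    unfolding J_def by (intro tendsto_intros f.tendsto x)
  moreover have "(\<lambda>j. d + 1 / Suc j) \<longlonglongrightarrow> d + 0"
    by (intro tendsto_intros LIMSEQ_Suc lim_1_over_n)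
  ultimately have Jx: "J x \<le> d"
    using v by (intro LIMSEQ_le) (auto intro: less_imp_le)
  show ?thesis
  proof
    fix w
    have "0 \<le> 2 * t * (inner x w - f w) + t\<^sup>2 * (norm w)\<^sup>2" for t
    proof -
      have "0 \<le> J (x + t *\<^sub>R w) - J x" using Jx dle[of "x + t *\<^sub>R w"] by linarith
      also have "\<dots> = 2 * t * (inner x w - f w) + t\<^sup>2 * (norm w)\<^sup>2"
        unfolding J_def f.scaleR f.add power2_norm_eq_inner
        by (simp add: inner_commute power2_eq_square algebra_simps)
      finally show ?thesis .
    qed
    from linear_coeff_zero_if_quadratic_nonneg[OF this] show "f w = inner x w" by simp
  qed
qed

text \<open>
  A diagonal argument makes the inner products with a countable dense set converge.  Since the
  sequence is bounded, the inner products with every vector are then Cauchy; their limit is a bounded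
  functional, and its Riesz representative is the weak limit.
\<close>
theorem weakly_convergent_subsequence:
  fixes x :: "nat \<Rightarrow> 'a::{real_inner, complete_space}"
  assumes "separable_space (euclidean :: 'a topology)" and M: "\<And>j. norm (x j) \<le> M"
  obtains r l where "strict_mono r" "weakly_converges (x \<circ> r) l"
proof -
  obtain C :: "'a set" where C: "countable C" "closure C = UNIV"
    using assms(1) by (auto simp: separable_space_def)
  have M0: "0 \<le> M" using M[of 0] norm_ge_zero[of "x 0"] by linarith
  define f where "f n w = inner (x n) (w /\<^sub>R (1 + norm w))" for n w
  have "norm (f n w) \<le> M" for n w
  proof -
    have "norm (f n w) \<le> norm (x n) * norm (w /\<^sub>R (1 + norm w))"
      using Cauchy_Schwarz_ineq2[of "x n" "w /\<^sub>R (1 + norm w)"] by (simp add: f_def)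
    also have "\<dots> \<le> M * 1"
    proof (intro mult_mono M)
      have "0 < 1 + norm w" using norm_ge_zero[of w] by linarith
      then show "norm (w /\<^sub>R (1 + norm w)) \<le> 1" by (simp add: divide_simps)
    qed (auto simp: M0)
    finally show ?thesis by simp
  qed
  then obtain r where r: "strict_mono r"
    and conv: "\<And>w. w \<in> C \<Longrightarrow> \<exists>l. (\<lambda>n. f (r n) w) \<longlonglongrightarrow> l"
    using function_convergent_subsequence[OF C(1), of f M] by metis
  have convC: "convergent (\<lambda>n. inner (x (r n)) w)" if "w \<in> C" for w
  proof -
    obtain l where "(\<lambda>n. f (r n) w) \<longlonglongrightarrow> l" using conv[OF \<open>w \<in> C\<close>] by blast
    then have "(\<lambda>n. (1 + norm w) * f (r n) w) \<longlonglongrightarrow> (1 + norm w) * l" by (intro tendsto_intros)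
    moreover have "1 + norm w \<noteq> 0"
      using norm_ge_zero[of w] by linarith
    then have "(1 + norm w) * f (r n) w = inner (x (r n)) w" for n
      by (simp add: f_def flip: mult.assoc)
    ultimately show ?thesis by (auto simp: convergent_def)
  qed
  have "Cauchy (\<lambda>n. inner (x (r n)) w)" for w
  proof (rule CauchyI)
    fix \<epsilon> :: real assume e: "0 < \<epsilon>"
    define \<eta> where "\<eta> = \<epsilon> / (3 * (M + 1))"
    have "0 < \<eta>" using e M0 by (simp add: \<eta>_def)
    have "w \<in> closure C" using C by simp
    then obtain z where z: "z \<in> C" "dist z w < \<eta>" using \<open>0 < \<eta>\<close> by (meson closure_approachable)
    have near: "\<bar>inner (x n) w - inner (x n) z\<bar> < \<epsilon> / 3" for n
    proof -
      have "\<bar>inner (x n) w - inner (x n) z\<bar> \<le> norm (x n) * norm (w - z)"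
        using Cauchy_Schwarz_ineq2[of "x n" "w - z"] by (simp add: inner_diff_right)
      also have "\<dots> \<le> M * \<eta>"
        using z M M0 by (intro mult_mono) (auto simp: dist_norm norm_minus_commute)
      also have "\<dots> < (M + 1) * \<eta>" using \<open>0 < \<eta>\<close> by (intro mult_strict_right_mono) auto
      also have "\<dots> = \<epsilon> / 3" using M0 by (simp add: \<eta>_def field_simps)
      finally show ?thesis .
    qed
    have "Cauchy (\<lambda>n. inner (x (r n)) z)" using convC[OF z(1)] by (simp add: Cauchy_convergent_iff)
    then obtain N where N: "\<And>i j. i \<ge> N \<Longrightarrow> j \<ge> N \<Longrightarrow> \<bar>inner (x (r i)) z - inner (x (r j)) z\<bar> < \<epsilon> / 3"
      using e unfolding Cauchy_iff by (metis divide_pos_pos real_norm_def zero_less_numeral)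
    show "\<exists>N. \<forall>i\<ge>N. \<forall>j\<ge>N. norm (inner (x (r i)) w - inner (x (r j)) w) < \<epsilon>"
    proof (intro exI allI impI)
      fix i j assume "N \<le> i" "N \<le> j"
      with N[of i j] near[of "r i"] near[of "r j"]
      show "norm (inner (x (r i)) w - inner (x (r j)) w) < \<epsilon>"
        unfolding real_norm_def by linarith
    qed
  qed
  then have "convergent (\<lambda>n. inner (x (r n)) w)" for w by (simp add: Cauchy_convergent_iff)
  then obtain L where L: "\<And>w. (\<lambda>n. inner (x (r n)) w) \<longlonglongrightarrow> L w" unfolding convergent_def by metis
  have "bounded_linear L"
  proof (rule bounded_linear_intro)
    fix w z and c :: real
    have "(\<lambda>n. inner (x (r n)) w + inner (x (r n)) z) \<longlonglongrightarrow> L w + L z" by (intro tendsto_intros L)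
    then show "L (w + z) = L w + L z"
      using L[of "w + z"] by (auto simp: inner_add_right intro: LIMSEQ_unique)
    have "(\<lambda>n. c * inner (x (r n)) w) \<longlonglongrightarrow> c * L w" by (intro tendsto_intros L)
    then show "L (c *\<^sub>R w) = c *\<^sub>R L w"
      using L[of "c *\<^sub>R w"] by (auto intro: LIMSEQ_unique)
    have "\<bar>inner (x n) w\<bar> \<le> M * norm w" for n
      using Cauchy_Schwarz_ineq2[of "x n" w] M[of n]
      by (meson mult_right_mono norm_ge_zero order_trans)
    moreover have "(\<lambda>n. \<bar>inner (x (r n)) w\<bar>) \<longlonglongrightarrow> \<bar>L w\<bar>" by (intro tendsto_intros L)
    ultimately show "norm (L w) \<le> norm w * M"
      by (intro LIMSEQ_le_const2[of "\<lambda>n. \<bar>inner (x (r n)) w\<bar>"]) (auto simp: mult.commute)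
  qed
  then obtain l where "\<And>w. L w = inner l w" using riesz_representation by blast
  with L have "weakly_converges (x \<circ> r) l" by (simp add: weakly_converges_def)
  with r that show ?thesis by blast
qed

section \<open>Symmetric bilinear forms and weak continuity\<close>

lemma symmetric_bilinear_bilinear: "symmetric_bilinear f \<Longrightarrow> bilinear f"
  by (simp add: symmetric_bilinear_def)

lemma symmetric_bilinear_commute: "symmetric_bilinear f \<Longrightarrow> f u v = f v u"
  by (simp add: symmetric_bilinear_def)

lemmas symmetric_bilinear_simps =
  bilinear_ladd[OF symmetric_bilinear_bilinear] bilinear_radd[OF symmetric_bilinear_bilinear]
  bilinear_lmul[OF symmetric_bilinear_bilinear] bilinear_rmul[OF symmetric_bilinear_bilinear]
  bilinear_lsub[OF symmetric_bilinear_bilinear] bilinear_rsub[OF symmetric_bilinear_bilinear]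
  bilinear_lzero[OF symmetric_bilinear_bilinear] bilinear_rzero[OF symmetric_bilinear_bilinear]

lemma symmetric_bilinear_linear_right: "symmetric_bilinear f \<Longrightarrow> linear (f u)"
  by (simp add: symmetric_bilinear_def bilinear_def)

lemma symmetric_bilinear_quadratic:
  assumes "symmetric_bilinear f"
  shows "f (u + x *\<^sub>R v) (u + x *\<^sub>R v) = f u u + 2 * x * f u v + x\<^sup>2 * f v v"
  using symmetric_bilinear_commute[OF assms, of v u]
  by (simp add: symmetric_bilinear_simps[OF assms] power2_eq_square algebra_simps)

lemma symmetric_bilinear_add:
  assumes "symmetric_bilinear f" "symmetric_bilinear g"
  shows "symmetric_bilinear (\<lambda>u v. f u v + r * g u v)"
  using assms unfolding symmetric_bilinear_def bilinear_def linear_iff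
  by (simp add: algebra_simps)

lemma symmetric_bilinear_scale:
  assumes "symmetric_bilinear f"
  shows "symmetric_bilinear (\<lambda>u v. r * f u v)"
  using assms unfolding symmetric_bilinear_def bilinear_def linear_iff
  by (simp add: algebra_simps)

lemma symmetric_bilinear_span_eq_0:
  assumes "symmetric_bilinear f" "\<And>v. v \<in> F \<Longrightarrow> f u v = 0" "p \<in> span F"
  shows "f u p = 0"
  using linear_eq_0_on_span[OF symmetric_bilinear_linear_right[OF assms(1)]] assms(2,3) by blast

lemma weakly_converges_const: "weakly_converges (\<lambda>_. v) v"
  by (simp add: weakly_converges_def)

lemma tendsto_imp_weakly_converges: "x \<longlonglongrightarrow> l \<Longrightarrow> weakly_converges x l"
  unfolding weakly_converges_def by (auto intro!: tendsto_intros)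

lemma weakly_continuousD:
  "weakly_continuous f \<Longrightarrow> weakly_converges x u \<Longrightarrow> weakly_converges y v \<Longrightarrow>
    (\<lambda>j. f (x j) (y j)) \<longlonglongrightarrow> f u v"
  by (simp add: weakly_continuous_def)

text \<open>
  Norm convergence implies weak convergence, so the form is continuous at the origin; a bilinear form
  that is continuous at the origin is bounded.
\<close>
lemma weakly_continuous_imp_bounded:
  fixes f :: "'a::real_inner \<Rightarrow> 'a \<Rightarrow> real"
  assumes sym: "symmetric_bilinear f" and wc: "weakly_continuous f"
  obtains C where "0 \<le> C" "\<And>u v. \<bar>f u v\<bar> \<le> C * norm u * norm v"
proof -
  have "\<exists>j::nat. \<forall>u v. \<bar>f u v\<bar> \<le> (real (Suc j))\<^sup>2 * norm u * norm v"
  proof (rule ccontr)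
    assume "\<not> ?thesis"
    then have "\<forall>j::nat. \<exists>u v. \<bar>f u v\<bar> > (real (Suc j))\<^sup>2 * norm u * norm v" by (meson not_less)
    then obtain u v where uv: "\<And>j. \<bar>f (u j) (v j)\<bar> > (real (Suc j))\<^sup>2 * norm (u j) * norm (v j)"
      by metis
    have nz: "u j \<noteq> 0" "v j \<noteq> 0" for j
      using uv[of j] by (auto simp: symmetric_bilinear_simps[OF sym])
    define x where "x j = (1 / Suc j) *\<^sub>R sgn (u j)" for j
    define y where "y j = (1 / Suc j) *\<^sub>R sgn (v j)" for j
    have lim: "(\<lambda>j. 1 / real (Suc j)) \<longlonglongrightarrow> 0" by (intro LIMSEQ_Suc lim_1_over_n)
    have "x \<longlonglongrightarrow> 0" "y \<longlonglongrightarrow> 0"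
      by (rule tendsto_norm_zero_cancel, use lim nz in \<open>simp add: x_def y_def norm_sgn\<close>)+
    then have "(\<lambda>j. f (x j) (y j)) \<longlonglongrightarrow> f 0 0"
      by (intro weakly_continuousD[OF wc] tendsto_imp_weakly_converges)
    then have "(\<lambda>j. \<bar>f (x j) (y j)\<bar>) \<longlonglongrightarrow> 0"
      by (simp add: symmetric_bilinear_simps[OF sym] tendsto_rabs_zero)
    moreover have "1 \<le> \<bar>f (x j) (y j)\<bar>" for j
    proof -
      have "\<bar>f (x j) (y j)\<bar> = \<bar>f (u j) (v j)\<bar> / ((real (Suc j))\<^sup>2 * norm (u j) * norm (v j))"
        by (simp add: x_def y_def sgn_div_norm symmetric_bilinear_simps[OF sym] abs_mult
            divide_inverse power2_eq_square del: of_nat_Suc)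
      then show ?thesis using uv[of j] nz[of j] by (simp add: le_divide_eq del: of_nat_Suc)
    qed
    ultimately show False
      using LIMSEQ_le_const[of "\<lambda>j. \<bar>f (x j) (y j)\<bar>" 0 1] by auto
  qed
  then obtain j :: nat where "\<forall>u v. \<bar>f u v\<bar> \<le> (real (Suc j))\<^sup>2 * norm u * norm v" by blast
  then show ?thesis by (intro that[of "(real (Suc j))\<^sup>2"]) auto
qed

text \<open>
  The bound is only known on the diagonal.  The identity
  \<open>4 f u v = f (u + v) (u + v) - f (u - v) (u - v)\<close> carries it to \<open>f u v\<close> for unit vectors \<open>u\<close>.
\<close>
lemma quadratically_bounded_imp_bounded_linear:
  fixes f :: "'a::real_normed_vector \<Rightarrow> 'a \<Rightarrow> real"
  assumes sym: "symmetric_bilinear f"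
    and f: "\<And>u. 0 \<le> f u u" "\<And>u. f u u \<le> \<kappa> * (norm u)\<^sup>2" and \<kappa>: "0 \<le> \<kappa>"
  shows "bounded_linear (\<lambda>u. f u v)"
proof (rule bounded_linear_intro)
  note simps = symmetric_bilinear_simps[OF sym]
  define K where "K = \<kappa> * (1 + norm v)\<^sup>2"
  have K: "\<bar>f u v\<bar> \<le> K" if "norm u = 1" for u
  proof -
    have "f (u + v) (u + v) - f (u - v) (u - v) = 4 * f u v"
      using symmetric_bilinear_commute[OF sym, of v u] by (simp add: simps algebra_simps)
    moreover have "f (u + v) (u + v) \<le> K"
      using that unfolding K_def
      by (intro order_trans[OF f(2)] mult_left_mono power_mono \<kappa>) (auto intro: order_trans[OF norm_triangle_ineq])
    moreover have "f (u - v) (u - v) \<le> K"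
      using that unfolding K_def
      by (intro order_trans[OF f(2)] mult_left_mono power_mono \<kappa>) (auto intro: order_trans[OF norm_triangle_ineq4])
    ultimately show ?thesis using f(1)[of "u + v"] f(1)[of "u - v"] by linarith
  qed
  fix u w and c :: real
  show "f (u + w) v = f u v + f w v" "f (c *\<^sub>R u) v = c *\<^sub>R f u v" by (simp_all add: simps)
  show "norm (f u v) \<le> norm u * K"
  proof (cases "u = 0")
    case False
    have "\<bar>f u v\<bar> = norm u * \<bar>f (sgn u) v\<bar>"
      using False by (simp add: sgn_div_norm simps abs_mult)
    also have "\<dots> \<le> norm u * K" using K[of "sgn u"] False by (intro mult_left_mono) (auto simp: norm_sgn)
    finally show ?thesis by simp
  qed (simp add: simps)
qed

lemma weakly_converges_bounded_linear:
  fixes x :: "nat \<Rightarrow> 'a::{real_inner, complete_space}"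
  assumes "weakly_converges x l" "bounded_linear f"
  shows "(\<lambda>j. f (x j)) \<longlonglongrightarrow> (f l :: real)"
proof -
  obtain y where "\<And>w. f w = inner y w" using riesz_representation[OF assms(2)] by blast
  then show ?thesis using assms(1) by (simp add: weakly_converges_def inner_commute[of y])
qed

section \<open>The forms attached to a parameter pair\<close>

locale coercive_pencil =
  fixes a b m :: "'a::{real_inner, complete_space} \<Rightarrow> 'a \<Rightarrow> real"
  assumes separable: "separable_space (euclidean :: 'a topology)"
    and sym_a: "symmetric_bilinear a" and coercive_a: "continuous_coercive a"
    and sym_b: "symmetric_bilinear b" and wc_b: "weakly_continuous b"
    and sym_m: "symmetric_bilinear m" and wc_m: "weakly_continuous m"
    and m_pos: "\<And>u. u \<noteq> 0 \<Longrightarrow> 0 < m u u"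
begin

lemmas a_simps = symmetric_bilinear_simps[OF sym_a]
lemmas b_simps = symmetric_bilinear_simps[OF sym_b]
lemmas m_simps = symmetric_bilinear_simps[OF sym_m]

lemma m_commute: "m u v = m v u"
  by (rule symmetric_bilinear_commute[OF sym_m])

lemma m_nonneg: "0 \<le> m u u"
  using m_pos[of u] by (cases "u = 0") (auto simp: m_simps)

text \<open>
  A pair \<open>(lam, t)\<close> is an eigenpoint exactly when this form is degenerate, and the number of
  eigenparameters up to \<open>t\<close> is governed by its sign.
\<close>
definition Q :: "real \<Rightarrow> real \<Rightarrow> 'a \<Rightarrow> 'a \<Rightarrow> real" where
  "Q lam t u v = a u v - lam * b u v - t * m u v"

lemma sym_Q: "symmetric_bilinear (Q lam t)"
  using symmetric_bilinear_add[OF symmetric_bilinear_add[OF sym_a sym_b, of "- lam"] sym_m, of "- t"]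
  by (simp add: Q_def[abs_def])

lemmas Q_simps = symmetric_bilinear_simps[OF sym_Q]

lemma Q_shift: "Q lam s u v = Q lam t u v + (t - s) * m u v"
  by (simp add: Q_def algebra_simps)

lemma Q_antimono: "s \<le> t \<Longrightarrow> Q lam t u u \<le> Q lam s u u"
  using mult_nonneg_nonneg[of "t - s" "m u u"] m_nonneg[of u] Q_shift[of lam s u u t] by auto

lemma is_eigenvector_iff_Q:
  "is_eigenvector a b m lam t u \<longleftrightarrow> u \<noteq> 0 \<and> (\<forall>v. Q lam t u v = 0)"
  by (auto simp: is_eigenvector_def Q_def algebra_simps)

text \<open>
  The terms in \<open>b\<close> and \<open>m\<close> converge along the sequence.  For the remaining one, positivity of
  \<open>a\<close> gives \<open>a x x \<ge> 2 a x l - a l l\<close>, and the right-hand side is weakly continuous in \<open>x\<close>.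
\<close>
lemma Q_weakly_lower_semicontinuous:
  assumes x: "weakly_converges x l" and le: "\<forall>\<^sub>F j in sequentially. Q lam t (x j) (x j) \<le> \<epsilon> j"
    and \<epsilon>: "\<epsilon> \<longlonglongrightarrow> 0"
  shows "Q lam t l l \<le> 0"
proof -
  obtain \<kappa>1 \<kappa>2 where \<kappa>: "0 < \<kappa>1" "\<kappa>1 \<le> \<kappa>2"
    and bd: "\<And>u. \<kappa>1 * (norm u)\<^sup>2 \<le> a u u" "\<And>u. a u u \<le> \<kappa>2 * (norm u)\<^sup>2"
    using coercive_a unfolding continuous_coercive_def by blast
  have pos: "0 \<le> a u u" for u
    using bd(1)[of u] \<kappa> by (meson mult_nonneg_nonneg order_trans less_imp_le zero_le_power2)
  have "bounded_linear (\<lambda>u. a u l)"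
    using \<kappa> by (intro quadratically_bounded_imp_bounded_linear[OF sym_a pos bd(2)]) auto
  then have "(\<lambda>j. a (x j) l) \<longlonglongrightarrow> a l l" using weakly_converges_bounded_linear[OF x] by blast
  then have "(\<lambda>j. 2 * a (x j) l - a l l - lam * b (x j) (x j) - t * m (x j) (x j)) \<longlonglongrightarrow>
      2 * a l l - a l l - lam * b l l - t * m l l"
    by (intro tendsto_intros weakly_continuousD[OF wc_b] weakly_continuousD[OF wc_m] x)
  also have "2 * a l l - a l l - lam * b l l - t * m l l = Q lam t l l" by (simp add: Q_def)
  finally show ?thesis
  proof (rule tendsto_le[OF sequentially_bot \<epsilon>])
    show "\<forall>\<^sub>F j in sequentially. 2 * a (x j) l - a l l - lam * b (x j) (x j) - t * m (x j) (x j) \<le> \<epsilon> j"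
      using le
    proof eventually_elim
      case (elim j)
      have "0 \<le> a (x j - l) (x j - l)" by (rule pos)
      also have "\<dots> = a (x j) (x j) - 2 * a (x j) l + a l l"
        using symmetric_bilinear_commute[OF sym_a, of l "x j"] by (simp add: a_simps)
      finally show ?case using elim by (simp add: Q_def)
    qed
  qed
qed

text \<open>
  This is where coercivity meets compactness.  If a weak limit of unit vectors were \<open>0\<close>, the terms
  in \<open>b\<close> and \<open>m\<close> would disappear in the limit, and the bound on \<open>Q\<close> would force \<open>a (u j) (u j)\<close>
  below the coercivity constant.
\<close>
lemma nonzero_weak_limit:
  assumes u: "\<And>j. norm (u j) = 1" and le: "\<And>j. Q lam T (u j) (u j) \<le> \<epsilon> j" and \<epsilon>: "\<epsilon> \<longlonglongrightarrow> 0"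
  obtains r x where "strict_mono r" "weakly_converges (u \<circ> r) x" "x \<noteq> 0"
proof -
  obtain r x where r: "strict_mono r" and x: "weakly_converges (u \<circ> r) x"
    using weakly_convergent_subsequence[OF separable, of u 1] u by auto
  obtain \<kappa> where \<kappa>: "0 < \<kappa>" and bd: "\<And>u. \<kappa> * (norm u)\<^sup>2 \<le> a u u"
    using coercive_a unfolding continuous_coercive_def by blast
  have "x \<noteq> 0"
  proof
    assume "x = 0"
    have "(\<lambda>j. \<epsilon> (r j)) \<longlonglongrightarrow> 0" using LIMSEQ_subseq_LIMSEQ[OF \<epsilon> r] by (simp add: o_def)
    then have "(\<lambda>j. \<epsilon> (r j) + lam * b ((u \<circ> r) j) ((u \<circ> r) j) + T * m ((u \<circ> r) j) ((u \<circ> r) j)) \<longlonglongrightarrow>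
        0 + lam * b x x + T * m x x"
      by (intro tendsto_intros weakly_continuousD[OF wc_b] weakly_continuousD[OF wc_m] x)
    moreover have "\<kappa> \<le> \<epsilon> (r j) + lam * b ((u \<circ> r) j) ((u \<circ> r) j) + T * m ((u \<circ> r) j) ((u \<circ> r) j)" for j
      using bd[of "u (r j)"] le[of "r j"] u[of "r j"] by (simp add: Q_def)
    ultimately have "\<kappa> \<le> 0 + lam * b x x + T * m x x" by (intro LIMSEQ_le_const) auto
    with \<kappa> show False by (simp add: \<open>x = 0\<close> b_simps m_simps)
  qed
  with r x that show ?thesis by blast
qed

definition perp :: "'a set \<Rightarrow> 'a set" where
  "perp F = {u. \<forall>f\<in>F. m u f = 0}"

lemma perp_scale: "u \<in> perp F \<Longrightarrow> c *\<^sub>R u \<in> perp F"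
  by (simp add: perp_def m_simps)

lemma perp_sgn: "u \<in> perp F \<Longrightarrow> sgn u \<in> perp F"
  by (simp add: sgn_div_norm perp_scale)

lemma perp_add: "u \<in> perp F \<Longrightarrow> v \<in> perp F \<Longrightarrow> u + v \<in> perp F"
  by (simp add: perp_def m_simps)

lemma perp_span: "u \<in> perp F \<Longrightarrow> p \<in> span F \<Longrightarrow> m u p = 0"
  by (rule symmetric_bilinear_span_eq_0[OF sym_m]) (auto simp: perp_def)

lemma perp_weakly_closed:
  assumes "weakly_converges x l" "\<forall>\<^sub>F j in sequentially. x j \<in> perp F"
  shows "l \<in> perp F"
proof -
  have "m l f = 0" if "f \<in> F" for f
  proof (rule LIMSEQ_unique)
    show "(\<lambda>j. m (x j) f) \<longlonglongrightarrow> m l f"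
      by (intro weakly_continuousD[OF wc_m] assms weakly_converges_const)
    have "\<forall>\<^sub>F j in sequentially. m (x j) f = 0"
      using assms(2) by eventually_elim (use that in \<open>simp add: perp_def\<close>)
    then show "(\<lambda>j. m (x j) f) \<longlonglongrightarrow> 0" by (simp add: tendsto_eventually)
  qed
  then show ?thesis by (simp add: perp_def)
qed

lemma Q_sgn: "Q lam t (sgn u) (sgn u) = Q lam t u u / (norm u)\<^sup>2"
  by (simp add: sgn_div_norm Q_simps power2_eq_square divide_inverse)

text \<open>
  Positivity on a weakly closed subspace is automatically uniform: unit vectors on which \<open>Q\<close> tends
  to \<open>0\<close> would have a nonzero weak limit at which \<open>Q\<close> is not positive.
\<close>
lemma Q_coercive_on_perp:
  assumes pos: "\<And>u. u \<in> perp F \<Longrightarrow> u \<noteq> 0 \<Longrightarrow> 0 < Q lam T u u"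
  obtains c where "0 < c" "\<And>u. u \<in> perp F \<Longrightarrow> c * (norm u)\<^sup>2 \<le> Q lam T u u"
proof -
  have "\<exists>j::nat. \<forall>u\<in>perp F. (1 / Suc j) * (norm u)\<^sup>2 \<le> Q lam T u u"
  proof (rule ccontr)
    assume "\<not> ?thesis"
    then have "\<forall>j::nat. \<exists>u. u \<in> perp F \<and> Q lam T u u < (1 / Suc j) * (norm u)\<^sup>2" by (meson not_less)
    then obtain u where u: "\<And>j. u j \<in> perp F" "\<And>j. Q lam T (u j) (u j) < (1 / Suc j) * (norm (u j))\<^sup>2"
      by metis
    have nz: "u j \<noteq> 0" for j using u(2)[of j] by (auto simp: Q_simps)
    define v where "v j = sgn (u j)" for j
    have v: "norm (v j) = 1" "v j \<in> perp F" "Q lam T (v j) (v j) \<le> 1 / Suc j" for j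
      using nz[of j] u[of j] by (auto simp: v_def norm_sgn Q_sgn divide_simps perp_sgn simp del: of_nat_Suc)
    have lim: "(\<lambda>j. 1 / real (Suc j)) \<longlonglongrightarrow> 0" by (intro LIMSEQ_Suc lim_1_over_n)
    obtain r x where r: "strict_mono r" and x: "weakly_converges (v \<circ> r) x" "x \<noteq> 0"
      using nonzero_weak_limit[OF v(1) v(3) lim] by blast
    have "x \<in> perp F" using x(1) by (rule perp_weakly_closed) (simp add: v)
    moreover have "Q lam T x x \<le> 0"
    proof (rule Q_weakly_lower_semicontinuous[OF x(1)])
      show "(\<lambda>j. 1 / real (Suc (r j))) \<longlonglongrightarrow> 0" using LIMSEQ_subseq_LIMSEQ[OF lim r] by (simp add: o_def)
    qed (use v in simp)
    ultimately show False using pos[of x] x(2) by simp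
  qed
  then obtain j :: nat where "\<forall>u\<in>perp F. (1 / Suc j) * (norm u)\<^sup>2 \<le> Q lam T u u" by blast
  then show ?thesis by (intro that[of "1 / Suc j"]) auto
qed

text \<open>
  The compactness step of the direct method, for parameters that vary along the sequence.  The
  limit vector serves every parameter that eventually bounds the sequence \<open>t\<close>, which covers both the
  case that \<open>t\<close> tends to a minimum and the case that it tends to \<open>- \<infinity>\<close>.
\<close>
lemma nonpositive_limit_on_perp:
  assumes t: "\<And>j. t j \<le> T"
    and ex: "\<And>j. \<exists>u\<in>perp F. u \<noteq> 0 \<and> Q lam (t j) u u \<le> 0"
  shows "\<exists>x\<in>perp F. x \<noteq> 0 \<and>
    (\<forall>s. (\<forall>\<^sub>F j in sequentially. t j \<le> s) \<longrightarrow> Q lam s x x \<le> 0)"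
proof -
  obtain u where u: "\<And>j. u j \<in> perp F" "\<And>j. u j \<noteq> 0" "\<And>j. Q lam (t j) (u j) (u j) \<le> 0"
    using ex by metis
  define v where "v j = sgn (u j)" for j
  have v: "norm (v j) = 1" "v j \<in> perp F" "Q lam (t j) (v j) (v j) \<le> 0" for j
    using u[of j] by (auto simp: v_def norm_sgn Q_sgn divide_simps perp_sgn)
  have le: "Q lam T (v j) (v j) \<le> 0" for j
    using v(3)[of j] Q_antimono[OF t] order_trans by blast
  obtain r x where r: "strict_mono r" and x: "weakly_converges (v \<circ> r) x" "x \<noteq> 0"
    using nonzero_weak_limit[of v lam T "\<lambda>_. 0"] v(1) le by auto
  show ?thesis
  proof (intro bexI conjI allI impI)
    show "x \<in> perp F" using x(1) by (rule perp_weakly_closed) (simp add: v)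
    show "x \<noteq> 0" by fact
    fix s assume "\<forall>\<^sub>F j in sequentially. t j \<le> s"
    then have "\<forall>\<^sub>F j in sequentially. t (r j) \<le> s" by (rule eventually_subseq[OF r])
    then have "\<forall>\<^sub>F j in sequentially. Q lam s ((v \<circ> r) j) ((v \<circ> r) j) \<le> 0"
    proof eventually_elim
      case (elim j)
      show ?case using v(3)[of "r j"] Q_antimono[OF elim, of lam "v (r j)"] by simp
    qed
    then show "Q lam s x x \<le> 0" by (rule Q_weakly_lower_semicontinuous[OF x(1)]) simp
  qed
qed

text \<open>
  The number \<open>\<rho>\<close> is the minimum of the Rayleigh quotient on the complement, obtained as the least
  parameter at which \<open>Q\<close> fails to be positive there.
\<close>
lemma minimal_parameter_on_perp:
  assumes u: "u \<in> perp F" "u \<noteq> 0" "Q lam T u u \<le> 0"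
  obtains \<rho> x where "\<rho> \<le> T" "x \<in> perp F" "x \<noteq> 0" "Q lam \<rho> x x = 0"
    "\<And>v. v \<in> perp F \<Longrightarrow> 0 \<le> Q lam \<rho> v v"
proof -
  define S where "S = {t. \<exists>u\<in>perp F. u \<noteq> 0 \<and> Q lam t u u \<le> 0}"
  have "T \<in> S" using u by (auto simp: S_def)
  \<comment> \<open>Otherwise a single nonzero vector would have Rayleigh quotient below every real number.\<close>
  have "bdd_below S"
  proof (rule ccontr)
    assume "\<not> bdd_below S"
    then have "\<exists>t\<in>S. t < min T (- real j)" for j unfolding bdd_below_def by (meson not_less)
    then obtain t where t: "\<And>j. t j \<in> S" "\<And>j. t j < min T (- real j)" by metis
    have tT: "t j \<le> T" for j using t(2)[of j] by simp
    have "\<exists>u\<in>perp F. u \<noteq> 0 \<and> Q lam (t j) u u \<le> 0" for j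
      using t(1)[of j] by (simp add: S_def)
    then have "\<exists>x\<in>perp F. x \<noteq> 0 \<and>
        (\<forall>s. (\<forall>\<^sub>F j in sequentially. t j \<le> s) \<longrightarrow> Q lam s x x \<le> 0)"
      by (rule nonpositive_limit_on_perp[OF tT])
    then obtain x where x: "x \<noteq> 0" "\<And>s. \<forall>\<^sub>F j in sequentially. t j \<le> s \<Longrightarrow> Q lam s x x \<le> 0"
      by blast
    define s where "s = (a x x - lam * b x x) / m x x - 1"
    obtain N :: nat where N: "- s \<le> real N" using real_arch_simple by blast
    have "\<forall>\<^sub>F j in sequentially. t j \<le> s"
    proof (rule eventually_sequentiallyI[of N])
      fix j assume "N \<le> j"
      then have "real N \<le> real j" by simp
      with t(2)[of j] N show "t j \<le> s" by linarith
    qed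
    then have "Q lam s x x \<le> 0" by (rule x(2))
    moreover have "Q lam s x x = m x x" using m_pos[OF x(1)] by (simp add: Q_def s_def field_simps)
    ultimately show False using m_pos[OF x(1)] by linarith
  qed
  define \<rho> where "\<rho> = Inf S"
  have \<rho>: "\<rho> \<le> t" if "t \<in> S" for t unfolding \<rho>_def using that \<open>bdd_below S\<close> by (rule cInf_lower)
  have "\<exists>t\<in>S. t < \<rho> + 1 / Suc j" for j
    using cInf_lessD[of S "\<rho> + 1 / Suc j"] \<open>T \<in> S\<close> by (auto simp: \<rho>_def)
  then obtain t where t: "\<And>j. t j \<in> S" "\<And>j. t j < \<rho> + 1 / Suc j" by metis
  have t1: "t j \<le> \<rho> + 1" for j
  proof -
    have "1 / real (Suc j) \<le> 1" by simp
    with t(2)[of j] show ?thesis by linarith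
  qed
  have "\<exists>u\<in>perp F. u \<noteq> 0 \<and> Q lam (t j) u u \<le> 0" for j
    using t(1)[of j] by (simp add: S_def)
  then have "\<exists>x\<in>perp F. x \<noteq> 0 \<and>
      (\<forall>s. (\<forall>\<^sub>F j in sequentially. t j \<le> s) \<longrightarrow> Q lam s x x \<le> 0)"
    by (rule nonpositive_limit_on_perp[OF t1])
  then obtain x where x: "x \<in> perp F" "x \<noteq> 0"
    and xs: "\<And>s. \<forall>\<^sub>F j in sequentially. t j \<le> s \<Longrightarrow> Q lam s x x \<le> 0"
    by blast
  have nonneg: "0 \<le> Q lam \<rho> v v" if "v \<in> perp F" for v
  proof (rule ccontr)
    assume neg: "\<not> 0 \<le> Q lam \<rho> v v"
    then have "v \<noteq> 0" by (auto simp: Q_simps)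
    then have mv: "0 < m v v" by (rule m_pos)
    define s where "s = \<rho> + Q lam \<rho> v v / m v v"
    have "Q lam s v v = 0" using mv Q_shift[of lam s v v \<rho>] by (simp add: s_def)
    then have "s \<in> S" using that \<open>v \<noteq> 0\<close> by (auto simp: S_def)
    then have "\<rho> \<le> s" by (rule \<rho>)
    with neg mv show False by (simp add: s_def zero_le_divide_iff)
  qed
  have "Q lam \<rho> x x \<le> 0"
  proof (rule ccontr)
    assume pos: "\<not> Q lam \<rho> x x \<le> 0"
    have mx: "0 < m x x" using m_pos x by blast
    define h where "h = Q lam \<rho> x x / (2 * m x x)"
    have h: "0 < h" using pos mx by (simp add: h_def)
    have "\<forall>\<^sub>F j in sequentially. 1 / real (Suc j) < h"
      using order_tendstoD(2)[OF LIMSEQ_Suc[OF lim_1_over_n] h] by simp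
    then have "\<forall>\<^sub>F j in sequentially. t j \<le> \<rho> + h"
    proof eventually_elim
      case (elim j)
      with t(2)[of j] show ?case by linarith
    qed
    then have "Q lam (\<rho> + h) x x \<le> 0" by (rule xs)
    moreover have "Q lam (\<rho> + h) x x = Q lam \<rho> x x / 2"
      using mx Q_shift[of lam "\<rho> + h" x x \<rho>] by (simp add: h_def)
    ultimately show False using pos by linarith
  qed
  with nonneg[OF x(1)] have "Q lam \<rho> x x = 0" by linarith
  with that[OF \<rho>[OF \<open>T \<in> S\<close>] x] nonneg show ?thesis by blast
qed

section \<open>Orthogonal projection with respect to m\<close>

definition m_orthogonal :: "'a set \<Rightarrow> bool" where
  "m_orthogonal F \<longleftrightarrow> 0 \<notin> F \<and> pairwise (\<lambda>f g. m f g = 0) F"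

lemma m_orthogonalD: "m_orthogonal F \<Longrightarrow> f \<in> F \<Longrightarrow> g \<in> F \<Longrightarrow> f \<noteq> g \<Longrightarrow> m f g = 0"
  by (auto simp: m_orthogonal_def pairwise_def)

lemma m_orthogonal_subset: "m_orthogonal F \<Longrightarrow> G \<subseteq> F \<Longrightarrow> m_orthogonal G"
  by (auto simp: m_orthogonal_def intro: pairwise_subset)

lemma m_orthogonal_insert:
  "m_orthogonal F \<Longrightarrow> x \<in> perp F \<Longrightarrow> x \<noteq> 0 \<Longrightarrow> m_orthogonal (insert x F)"
  by (auto simp: m_orthogonal_def pairwise_insert perp_def m_commute[of _ x])

lemma perp_notin: "x \<in> perp F \<Longrightarrow> x \<noteq> 0 \<Longrightarrow> x \<notin> F"
  using m_pos[of x] by (auto simp: perp_def)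

text \<open>
  Pairing with a member \<open>f\<close> of the family kills the span of the other members but not \<open>f\<close>.
\<close>
lemma m_orthogonal_independent:
  assumes "m_orthogonal F"
  shows "independent F"
proof
  assume "dependent F"
  then obtain f where f: "f \<in> F" "f \<in> span (F - {f})" by (auto simp: dependent_def)
  have "f \<in> perp (F - {f})" using m_orthogonalD[OF assms f(1)] by (auto simp: perp_def)
  then have "m f f = 0" using f(2) by (rule perp_span)
  moreover have "f \<noteq> 0" using f(1) assms by (auto simp: m_orthogonal_def)
  ultimately show False using m_pos[of f] by simp
qed

definition m_proj :: "'a set \<Rightarrow> 'a \<Rightarrow> 'a" where
  "m_proj F v = (\<Sum>f\<in>F. (m v f / m f f) *\<^sub>R f)"

lemma m_proj_linear: "linear (m_proj F)"
  by (rule linearI)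
    (simp_all add: m_proj_def m_simps add_divide_distrib scaleR_add_left sum.distrib scaleR_sum_right)

lemma m_proj_in_span: "m_proj F v \<in> span F"
  unfolding m_proj_def by (intro span_sum span_scale span_base)

lemma m_proj_perp:
  assumes "finite F" "m_orthogonal F"
  shows "v - m_proj F v \<in> perp F"
proof -
  have "m (m_proj F v) g = m v g" if "g \<in> F" for g
  proof -
    have "m (m_proj F v) g = m g (m_proj F v)" by (rule m_commute)
    also have "\<dots> = (\<Sum>f\<in>F. (m v f / m f f) * m g f)"
      by (simp add: m_proj_def linear_sum[OF symmetric_bilinear_linear_right[OF sym_m]] m_simps)
    also have "\<dots> = (\<Sum>f\<in>F. if f = g then m v f else 0)"
    proof (rule sum.cong[OF refl])
      fix f assume "f \<in> F"
      then have "f \<noteq> 0" using assms(2) by (auto simp: m_orthogonal_def)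
      then show "(m v f / m f f) * m g f = (if f = g then m v f else 0)"
        using m_orthogonalD[OF assms(2) that \<open>f \<in> F\<close>] m_pos[of f] by auto
    qed
    also have "\<dots> = m v g" using assms(1) that by simp
    finally show ?thesis .
  qed
  then show ?thesis by (simp add: perp_def m_simps)
qed

text \<open>
  The \<open>m\<close>-orthogonal projection maps \<open>span B\<close> to a space of smaller dimension, hence is not
  injective there.  This dimension count relates subspaces on which \<open>Q\<close> has a sign to the number
  of eigenparameters.
\<close>
lemma span_meets_perp:
  assumes F: "finite F" "m_orthogonal F" and B: "independent B" "card F < card B"
  obtains w where "w \<in> span B" "w \<noteq> 0" "w \<in> perp F"
proof -
  have "\<not> inj_on (m_proj F) (span B)"
  proof
    assume inj: "inj_on (m_proj F) (span B)"
    then have "independent (m_proj F ` B)"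
      by (intro linear_independent_injective_image[OF m_proj_linear B(1)])
    then have "card (m_proj F ` B) \<le> card F"
      using independent_span_bound[OF F(1)] m_proj_in_span by blast
    moreover have "card (m_proj F ` B) = card B"
      using inj span_superset by (intro card_image) (rule inj_on_subset)
    ultimately show False using B(2) by simp
  qed
  then obtain w where "w \<in> span B" "w \<noteq> 0" "m_proj F w = 0"
    using linear_injective_on_subspace_0[OF m_proj_linear subspace_span, of F B] by blast
  with m_proj_perp[OF F, of w] that show ?thesis by simp
qed

section \<open>Orthogonal families of eigenvectors\<close>

definition rayleigh :: "real \<Rightarrow> 'a \<Rightarrow> real" where
  "rayleigh lam u = (a u u - lam * b u u) / m u u"

lemma is_eigenvector_imp_rayleigh:
  assumes "is_eigenvector a b m lam t u"
  shows "t = rayleigh lam u"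
proof -
  have "u \<noteq> 0" "a u u = lam * b u u + t * m u u" using assms by (auto simp: is_eigenvector_def)
  with m_pos[of u] show ?thesis by (simp add: rayleigh_def)
qed

lemma eigenvector_Q:
  assumes "is_eigenvector a b m lam s u"
  shows "Q lam t u v = (s - t) * m u v"
  using assms Q_shift[of lam t u v s] by (simp add: is_eigenvector_iff_Q)

lemma eigenvectors_m_orthogonal:
  assumes "is_eigenvector a b m lam s u" "is_eigenvector a b m lam t v" "s \<noteq> t"
  shows "m u v = 0"
proof -
  have "(s - t) * m u v = Q lam t v u"
    using eigenvector_Q[OF assms(1), of t v] symmetric_bilinear_commute[OF sym_Q, of lam t u v] by simp
  also have "\<dots> = 0" using eigenvector_Q[OF assms(2), of t u] by simp
  finally show ?thesis using assms(3) by simp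
qed

text \<open>
  The eigenparameter of an eigenvector is its Rayleigh quotient, so a set of vectors determines the
  eigenparameters of its members.
\<close>
definition eigenfamily :: "real \<Rightarrow> real \<Rightarrow> 'a set \<Rightarrow> bool" where
  "eigenfamily lam T F \<longleftrightarrow> m_orthogonal F \<and>
     (\<forall>f\<in>F. rayleigh lam f \<le> T \<and> is_eigenvector a b m lam (rayleigh lam f) f)"

lemma eigenfamily_m_orthogonal: "eigenfamily lam T F \<Longrightarrow> m_orthogonal F"
  by (simp add: eigenfamily_def)

lemma eigenfamily_independent: "eigenfamily lam T F \<Longrightarrow> independent F"
  by (simp add: eigenfamily_m_orthogonal m_orthogonal_independent)

text \<open>
  The minimiser of the Rayleigh quotient on \<open>perp F\<close> annihilates \<open>perp F\<close> under \<open>Q lam \<rho>\<close> by the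
  first-order condition.  It also annihilates \<open>span F\<close>, because the members of \<open>F\<close> are eigenvectors
  to which it is \<open>m\<close>-orthogonal.  Together these two subspaces span the whole space.
\<close>
lemma eigenvector_in_perp:
  assumes F: "finite F" "eigenfamily lam T F"
    and u: "u \<in> perp F" "u \<noteq> 0" "Q lam T u u \<le> 0"
  obtains x where "x \<in> perp F" "x \<noteq> 0" "rayleigh lam x \<le> T"
    "is_eigenvector a b m lam (rayleigh lam x) x"
proof -
  obtain \<rho> x where \<rho>: "\<rho> \<le> T" and x: "x \<in> perp F" "x \<noteq> 0" "Q lam \<rho> x x = 0"
    and nonneg: "\<And>v. v \<in> perp F \<Longrightarrow> 0 \<le> Q lam \<rho> v v"
    by (rule minimal_parameter_on_perp[OF u]) (rule that)
  have on_perp: "Q lam \<rho> x v = 0" if "v \<in> perp F" for v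
  proof (rule linear_coeff_zero_if_quadratic_nonneg)
    fix t
    have "0 \<le> Q lam \<rho> (x + t *\<^sub>R v) (x + t *\<^sub>R v)"
      using that x by (intro nonneg perp_add perp_scale)
    then show "0 \<le> 2 * t * Q lam \<rho> x v + t\<^sup>2 * Q lam \<rho> v v"
      by (simp add: symmetric_bilinear_quadratic[OF sym_Q] x)
  qed
  have on_span: "Q lam \<rho> x p = 0" if "p \<in> span F" for p
  proof (rule symmetric_bilinear_span_eq_0[OF sym_Q _ that])
    fix f assume "f \<in> F"
    then have "Q lam \<rho> f x = (rayleigh lam f - \<rho>) * m f x"
      using F(2) by (intro eigenvector_Q) (auto simp: eigenfamily_def)
    also have "m f x = 0" using x(1) \<open>f \<in> F\<close> by (auto simp: perp_def m_commute[of f])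
    finally show "Q lam \<rho> x f = 0" using symmetric_bilinear_commute[OF sym_Q, of lam \<rho> x f] by simp
  qed
  have "Q lam \<rho> x v = 0" for v
  proof -
    have "v - m_proj F v \<in> perp F"
      using F by (intro m_proj_perp) (auto simp: eigenfamily_def)
    from on_perp[OF this] on_span[OF m_proj_in_span[of F v]] show ?thesis by (simp add: Q_simps)
  qed
  then have "is_eigenvector a b m lam \<rho> x" using x by (simp add: is_eigenvector_iff_Q)
  moreover from is_eigenvector_imp_rayleigh[OF this] have "\<rho> = rayleigh lam x" .
  ultimately show ?thesis using that[OF x(1,2)] \<rho> by simp
qed

text \<open>
  A weak limit \<open>x\<close> of distinct normalised members is \<open>m\<close>-orthogonal to each of them, hence also to
  their weak limit, which is \<open>x\<close> itself; so \<open>m x x = 0\<close>, although \<open>nonzero_weak_limit\<close> gives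
  \<open>x \<noteq> 0\<close>.
\<close>
lemma eigenfamily_finite:
  assumes "eigenfamily lam T F"
  shows "finite F"
proof (rule ccontr)
  assume "infinite F"
  then obtain f :: "nat \<Rightarrow> 'a" where f: "inj f" "range f \<subseteq> F" using infinite_countable_subset by blast
  have F: "m_orthogonal F" using assms by (simp add: eigenfamily_def)
  have nz: "f j \<noteq> 0" for j using f(2) F unfolding m_orthogonal_def by (metis rangeI subsetD)
  define u where "u j = sgn (f j)" for j
  have u: "norm (u j) = 1" for j using nz by (simp add: u_def norm_sgn)
  have "Q lam T (u j) (u j) \<le> 0" for j
  proof -
    have "f j \<in> F" using f(2) by auto
    with assms have "is_eigenvector a b m lam (rayleigh lam (f j)) (f j)" "rayleigh lam (f j) \<le> T"
      by (auto simp: eigenfamily_def)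
    then have "Q lam T (f j) (f j) \<le> 0"
      by (simp add: eigenvector_Q m_nonneg mult_nonpos_nonneg)
    then show ?thesis by (simp add: u_def Q_sgn divide_nonpos_nonneg)
  qed
  then obtain r x where r: "strict_mono r" and x: "weakly_converges (u \<circ> r) x" "x \<noteq> 0"
    by (rule nonzero_weak_limit[of u lam T "\<lambda>_. 0", OF u _ tendsto_const])
  have "x \<in> perp {u i}" for i
  proof (rule perp_weakly_closed[OF x(1)])
    show "\<forall>\<^sub>F j in sequentially. (u \<circ> r) j \<in> perp {u i}"
    proof (rule eventually_sequentiallyI[of "Suc i"])
      fix j assume "Suc i \<le> j"
      then have "r j \<noteq> i" using seq_suble[OF r, of j] by linarith
      then have "m (f (r j)) (f i) = 0"
        using f by (intro m_orthogonalD[OF F]) (auto simp: inj_def)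
      then show "(u \<circ> r) j \<in> perp {u i}"
        by (simp add: perp_def u_def sgn_div_norm m_simps)
    qed
  qed
  then have "x \<in> perp (range u)" by (auto simp: perp_def)
  then have "m x ((u \<circ> r) j) = 0" for j by (auto simp: perp_def)
  moreover have "(\<lambda>j. m x ((u \<circ> r) j)) \<longlonglongrightarrow> m x x"
    by (intro weakly_continuousD[OF wc_m] weakly_converges_const x)
  ultimately have "m x x = 0" by (simp add: LIMSEQ_const_iff)
  with m_pos[OF x(2)] show False by simp
qed

text \<open>
  Take a maximal family by Zorn's lemma.  If \<open>Q\<close> were not positive on its complement, the complement
  would contain a further eigenvector and the family could be enlarged.
\<close>
lemma maximal_eigenfamily:
  obtains F where "eigenfamily lam T F" "\<And>u. u \<in> perp F \<Longrightarrow> u \<noteq> 0 \<Longrightarrow> 0 < Q lam T u u"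
proof -
  have "\<exists>F\<in>Collect (eigenfamily lam T). \<forall>X\<in>Collect (eigenfamily lam T). F \<subseteq> X \<longrightarrow> X = F"
  proof (rule subset_Zorn')
    fix C assume C: "subset.chain (Collect (eigenfamily lam T)) C"
    have "pairwise (\<lambda>f g. m f g = 0) (\<Union>C)"
    proof (rule pairwise_chain_Union)
      show "pairwise (\<lambda>f g. m f g = 0) S" if "S \<in> C" for S
        using C that by (auto simp: subset.chain_def eigenfamily_def m_orthogonal_def)
      show "chain\<^sub>\<subseteq> C" using C by (auto simp: subset.chain_def chain_subset_def)
    qed
    then show "\<Union>C \<in> Collect (eigenfamily lam T)"
      using C by (auto simp: subset.chain_def eigenfamily_def m_orthogonal_def)
  qed
  then obtain F where F: "eigenfamily lam T F"
    and max: "\<And>X. eigenfamily lam T X \<Longrightarrow> F \<subseteq> X \<Longrightarrow> X = F" by blast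
  have "0 < Q lam T u u" if u: "u \<in> perp F" "u \<noteq> 0" for u
  proof (rule ccontr)
    assume "\<not> 0 < Q lam T u u"
    then obtain x where x: "x \<in> perp F" "x \<noteq> 0" "rayleigh lam x \<le> T"
      "is_eigenvector a b m lam (rayleigh lam x) x"
      using eigenvector_in_perp[OF eigenfamily_finite[OF F] F u] by (auto simp: not_less)
    then have "eigenfamily lam T (insert x F)"
      using F by (auto simp: eigenfamily_def intro: m_orthogonal_insert)
    then have "insert x F = F" by (rule max) auto
    with perp_notin[OF x(1,2)] show False by blast
  qed
  with F that show ?thesis by blast
qed

lemma eigenfamily_Q_span_nonpos:
  assumes "finite F" "eigenfamily lam T F" "p \<in> span F"
  shows "Q lam T p p \<le> 0"
  using assms
proof (induction F arbitrary: p)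
  case empty
  then show ?case by (simp add: Q_simps)
next
  case (insert f F)
  have fam: "eigenfamily lam T F"
    using insert.prems(1) by (auto simp: eigenfamily_def intro: m_orthogonal_subset)
  obtain k where k: "p - k *\<^sub>R f \<in> span F" using insert.prems(2) by (auto simp: span_breakdown_eq)
  define w where "w = p - k *\<^sub>R f"
  have f: "rayleigh lam f \<le> T" "is_eigenvector a b m lam (rayleigh lam f) f"
    using insert.prems(1) by (auto simp: eigenfamily_def)
  have "f \<in> perp F"
    using insert.prems(1) insert.hyps
    by (auto simp: eigenfamily_def m_orthogonal_def pairwise_insert perp_def)
  then have "m f w = 0" using k by (simp add: w_def perp_span)
  then have "Q lam T w f = 0"
    using eigenvector_Q[OF f(2), of T w] symmetric_bilinear_commute[OF sym_Q, of lam T w f] by simp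
  moreover have "Q lam T w w \<le> 0" using insert.IH[OF fam] k by (simp add: w_def)
  moreover have "Q lam T f f \<le> 0"
    using f eigenvector_Q[OF f(2), of T f] by (simp add: m_nonneg mult_nonpos_nonneg)
  moreover have "Q lam T p p = Q lam T (w + k *\<^sub>R f) (w + k *\<^sub>R f)" by (simp add: w_def)
  ultimately show ?case
    by (simp add: symmetric_bilinear_quadratic[OF sym_Q] add_nonpos_nonpos mult_nonneg_nonpos)
qed

text \<open>
  Subtract from an eigenvector its projection to the members with the same eigenparameter.  The
  remainder is \<open>m\<close>-orthogonal to the whole family, while \<open>Q\<close> is not positive on it; so it vanishes.
\<close>
lemma eigenspace_eq_span:
  assumes F: "eigenfamily lam T F" and pos: "\<And>u. u \<in> perp F \<Longrightarrow> u \<noteq> 0 \<Longrightarrow> 0 < Q lam T u u"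
    and t: "t \<le> T"
  shows "eigenspace a b m lam t = span {f\<in>F. rayleigh lam f = t}"
proof
  define G where "G = {f\<in>F. rayleigh lam f = t}"
  have G: "finite G" "m_orthogonal G"
    using eigenfamily_finite[OF F] F by (auto simp: G_def eigenfamily_def intro: m_orthogonal_subset)
  have Gev: "is_eigenvector a b m lam t f" if "f \<in> G" for f
    using that F by (auto simp: G_def eigenfamily_def)
  have in_span: "Q lam t p v = 0" if "p \<in> span G" for p v
  proof -
    have "Q lam t v p = 0"
    proof (rule symmetric_bilinear_span_eq_0[OF sym_Q _ that])
      show "Q lam t v f = 0" if "f \<in> G" for f
        using eigenvector_Q[OF Gev[OF that], of t v] symmetric_bilinear_commute[OF sym_Q, of lam t v f]
        by simp
    qed
    then show ?thesis using symmetric_bilinear_commute[OF sym_Q, of lam t v p] by simp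
  qed
  then show "span {f\<in>F. rayleigh lam f = t} \<subseteq> eigenspace a b m lam t"
    by (auto simp: eigenspace_def is_eigenvector_iff_Q G_def)
  show "eigenspace a b m lam t \<subseteq> span {f\<in>F. rayleigh lam f = t}"
  proof
    fix u assume u: "u \<in> eigenspace a b m lam t"
    show "u \<in> span {f\<in>F. rayleigh lam f = t}"
    proof (cases "u = 0")
      case False
      with u have ev: "is_eigenvector a b m lam t u" by (simp add: eigenspace_def)
      define w where "w = u - m_proj G u"
      have "w \<in> perp F"
      proof -
        have "m w f = 0" if "f \<in> F" for f
        proof (cases "f \<in> G")
          case True
          then show ?thesis using m_proj_perp[OF G, of u] by (simp add: perp_def w_def)
        next
          case False
          with that F have evf: "is_eigenvector a b m lam (rayleigh lam f) f" and ne: "t \<noteq> rayleigh lam f"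
            by (auto simp: G_def eigenfamily_def)
          have "f \<in> perp G" using that False F
            by (auto simp: perp_def G_def eigenfamily_def intro: m_orthogonalD)
          then have "m f (m_proj G u) = 0" using m_proj_in_span by (rule perp_span)
          then show ?thesis
            using eigenvectors_m_orthogonal[OF ev evf ne] m_commute[of f "m_proj G u"]
            by (simp add: w_def m_simps)
        qed
        then show ?thesis by (simp add: perp_def)
      qed
      moreover have "Q lam T w w \<le> 0"
      proof -
        have "Q lam t w w = 0"
          using ev in_span[OF m_proj_in_span, of u] by (simp add: w_def Q_simps is_eigenvector_iff_Q)
        then show ?thesis using Q_antimono[OF t, of lam w] by simp
      qed
      ultimately have "w = 0" using pos[of w] by force
      then show ?thesis using m_proj_in_span[of G u] by (simp add: w_def G_def)
    qed (simp add: span_zero)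
  qed
qed

section \<open>Counting eigenparameters by the sign of the form\<close>

definition eigencount :: "real \<Rightarrow> real \<Rightarrow> nat" where
  "eigencount lam T = (\<Sum>t | eigenpoint a b m lam t \<and> t \<le> T. dim (eigenspace a b m lam t))"

text \<open>
  Each eigenspace is spanned by the members of a maximal family that have its eigenparameter, so the
  multiplicities add up to the size of the family.
\<close>
theorem spectral_decomposition:
  obtains F c where "finite F" "eigenfamily lam T F" "card F = eigencount lam T"
    "{t. eigenpoint a b m lam t \<and> t \<le> T} = rayleigh lam ` F"
    "\<And>t. t \<le> T \<Longrightarrow> eigenspace a b m lam t = span {f\<in>F. rayleigh lam f = t}"
    "0 < c" "\<And>u. u \<in> perp F \<Longrightarrow> c * (norm u)\<^sup>2 \<le> Q lam T u u"
    "\<And>p. p \<in> span F \<Longrightarrow> Q lam T p p \<le> 0"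
proof -
  obtain F where F: "eigenfamily lam T F"
    and pos: "\<And>u. u \<in> perp F \<Longrightarrow> u \<noteq> 0 \<Longrightarrow> 0 < Q lam T u u"
    by (rule maximal_eigenfamily[of lam T]) (rule that)
  obtain c where c: "0 < c" "\<And>u. u \<in> perp F \<Longrightarrow> c * (norm u)\<^sup>2 \<le> Q lam T u u"
    by (rule Q_coercive_on_perp[of F lam T]) (erule (1) pos, rule that)
  have fin: "finite F" using F by (rule eigenfamily_finite)
  have espace: "eigenspace a b m lam t = span {f\<in>F. rayleigh lam f = t}" if "t \<le> T" for t
    using F pos that by (rule eigenspace_eq_span)
  have dim: "dim (eigenspace a b m lam t) = card {f\<in>F. rayleigh lam f = t}" if "t \<le> T" for t
  proof -
    have "independent {f\<in>F. rayleigh lam f = t}"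
      using F by (intro m_orthogonal_independent) (auto simp: eigenfamily_def intro: m_orthogonal_subset)
    then show ?thesis by (simp add: espace[OF that] dim_eq_card_independent)
  qed
  have points: "{t. eigenpoint a b m lam t \<and> t \<le> T} = rayleigh lam ` F"
  proof (intro equalityI subsetI)
    fix t assume "t \<in> {t. eigenpoint a b m lam t \<and> t \<le> T}"
    then obtain u where u: "is_eigenvector a b m lam t u" "t \<le> T" by (auto simp: eigenpoint_def)
    then have "u \<in> span {f\<in>F. rayleigh lam f = t}" "u \<noteq> 0"
      using espace by (auto simp: eigenspace_def is_eigenvector_def)
    then have "{f\<in>F. rayleigh lam f = t} \<noteq> {}" by force
    then show "t \<in> rayleigh lam ` F" by auto
  qed (use F in \<open>auto simp: eigenfamily_def eigenpoint_def\<close>)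
  have "eigencount lam T = (\<Sum>t\<in>rayleigh lam ` F. card {f\<in>F. rayleigh lam f = t})"
    unfolding eigencount_def points using F by (intro sum.cong dim) (auto simp: eigenfamily_def)
  also have "\<dots> = card F" using sum.image_gen[OF fin, of "\<lambda>_. 1::nat" "rayleigh lam"] by simp
  finally have "card F = eigencount lam T" ..
  with that[OF fin F _ points espace c eigenfamily_Q_span_nonpos[OF fin F]] show ?thesis by blast
qed

text \<open>
  Otherwise \<open>span B\<close> would meet the complement of the eigenvectors, on which \<open>Q\<close> is positive.  This
  and the next lemma replace the minimax principle.
\<close>
lemma eigencount_ge_if_nonpos_on_span:
  assumes B: "independent B" and nonpos: "\<And>u. u \<in> span B \<Longrightarrow> Q lam T u u \<le> 0"
  shows "card B \<le> eigencount lam T"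
proof (rule ccontr)
  assume less: "\<not> card B \<le> eigencount lam T"
  obtain F c where F: "finite F" "eigenfamily lam T F" "card F = eigencount lam T"
    and c: "0 < c" "\<And>u. u \<in> perp F \<Longrightarrow> c * (norm u)\<^sup>2 \<le> Q lam T u u"
    by (rule spectral_decomposition[of lam T]) blast
  obtain w where w: "w \<in> span B" "w \<noteq> 0" "w \<in> perp F"
    using F less by (auto intro: span_meets_perp[OF F(1) _ B] simp: eigenfamily_def)
  then have "0 < c * (norm w)\<^sup>2" using c(1) by simp
  then show False using c(2)[OF w(3)] nonpos[OF w(1)] by linarith
qed

text \<open>
  Otherwise the span of the eigenvectors, on which \<open>Q\<close> is nonpositive, would meet \<open>perp G\<close>.
\<close>
lemma eigencount_le_if_pos_on_perp:
  assumes G: "finite G" "m_orthogonal G"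
    and pos: "\<And>u. u \<in> perp G \<Longrightarrow> u \<noteq> 0 \<Longrightarrow> 0 < Q lam T u u"
  shows "eigencount lam T \<le> card G"
proof (rule ccontr)
  assume less: "\<not> eigencount lam T \<le> card G"
  obtain F where F: "finite F" "eigenfamily lam T F" "card F = eigencount lam T"
    and nonpos: "\<And>p. p \<in> span F \<Longrightarrow> Q lam T p p \<le> 0"
    by (rule spectral_decomposition[of lam T]) blast
  have "independent F" using F(2) by (rule eigenfamily_independent)
  then obtain w where "w \<in> span F" "w \<noteq> 0" "w \<in> perp G"
    using F less by (auto intro: span_meets_perp[OF G])
  then show False using pos[of w] nonpos[of w] by force
qed

lemma eigencount_mono: "s \<le> t \<Longrightarrow> eigencount lam s \<le> eigencount lam t"
proof -
  assume st: "s \<le> t"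
  obtain F where F: "eigenfamily lam s F" "card F = eigencount lam s"
    and nonpos: "\<And>p. p \<in> span F \<Longrightarrow> Q lam s p p \<le> 0"
    by (rule spectral_decomposition[of lam s]) blast
  have "card F \<le> eigencount lam t"
  proof (rule eigencount_ge_if_nonpos_on_span)
    show "independent F" using F(1) by (rule eigenfamily_independent)
    show "Q lam t u u \<le> 0" if "u \<in> span F" for u
      using nonpos[OF that] Q_antimono[OF st, of lam u] by linarith
  qed
  with F show ?thesis by simp
qed

end

section \<open>Perturbation of a form with a one-dimensional kernel\<close>

text \<open>
  If \<open>G\<close> is coercive in the directions \<open>v\<close> and has \<open>e\<close> in its kernel, a perturbation \<open>\<delta> H\<close> only has
  to be positive at \<open>e\<close>: the cross term \<open>2 x H v e\<close> is absorbed partly by \<open>x\<^sup>2 H e e\<close> and partly by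
  \<open>c \<parallel>v\<parallel>\<^sup>2\<close>, which does not shrink with \<open>\<delta>\<close>.  The threshold \<open>r\<close> is uniform in \<open>v\<close> and \<open>x\<close>.
\<close>
lemma perturbed_form_positive:
  fixes G H :: "'a::real_normed_vector \<Rightarrow> 'a \<Rightarrow> real"
  assumes G: "symmetric_bilinear G" and H: "symmetric_bilinear H"
    and bound: "0 \<le> C" "\<And>u v. \<bar>H u v\<bar> \<le> C * norm u * norm v"
    and c: "0 < c" and e: "G e e = 0" "0 < H e e"
  obtains r where "0 < r"
    "\<And>\<delta> v x. 0 < \<delta> \<Longrightarrow> \<delta> < r \<Longrightarrow> c * (norm v)\<^sup>2 \<le> G v v \<Longrightarrow> G v e = 0 \<Longrightarrow> v + x *\<^sub>R e \<noteq> 0 \<Longrightarrow>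
       0 < G (v + x *\<^sub>R e) (v + x *\<^sub>R e) + \<delta> * H (v + x *\<^sub>R e) (v + x *\<^sub>R e)"
proof -
  define \<eta> where "\<eta> = H e e"
  define K where "K = C + 2 * C\<^sup>2 * (norm e)\<^sup>2 / \<eta>"
  have \<eta>: "0 < \<eta>" using e by (simp add: \<eta>_def)
  have K: "0 \<le> K" using \<eta> bound(1) by (simp add: K_def)
  have H_lower: "\<eta> / 2 * x\<^sup>2 - K * (norm v)\<^sup>2 \<le> H (v + x *\<^sub>R e) (v + x *\<^sub>R e)" for v x
  proof -
    define p where "p = C * norm v * norm e"
    have "0 \<le> (\<eta> * \<bar>x\<bar> - 2 * p)\<^sup>2 / (2 * \<eta>)" using \<eta> by simp
    also have "\<dots> = \<eta> / 2 * x\<^sup>2 - 2 * \<bar>x\<bar> * p + 2 * p\<^sup>2 / \<eta>"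
      using \<eta> by (simp add: power2_diff power_mult_distrib field_simps) (simp add: power2_eq_square)
    finally have "2 * \<bar>x\<bar> * p \<le> \<eta> / 2 * x\<^sup>2 + 2 * p\<^sup>2 / \<eta>" by simp
    moreover have "\<bar>2 * x * H v e\<bar> \<le> 2 * \<bar>x\<bar> * p"
      using mult_left_mono[OF bound(2)[of v e], of "2 * \<bar>x\<bar>"] by (simp add: abs_mult p_def)
    moreover have "\<bar>H v v\<bar> \<le> C * (norm v)\<^sup>2"
      using bound(2)[of v v] by (simp add: power2_eq_square mult.assoc)
    moreover have "K * (norm v)\<^sup>2 = C * (norm v)\<^sup>2 + 2 * p\<^sup>2 / \<eta>"
      by (simp add: K_def p_def power_mult_distrib algebra_simps)
    moreover have "H (v + x *\<^sub>R e) (v + x *\<^sub>R e) = H v v + 2 * x * H v e + x\<^sup>2 * \<eta>"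
      by (simp add: symmetric_bilinear_quadratic[OF H] \<eta>_def)
    ultimately show ?thesis by (simp add: algebra_simps abs_le_iff)
  qed
  show ?thesis
  proof
    show "0 < c / (K + 1)" using c K by simp
    fix \<delta> x :: real and v :: 'a
    assume \<delta>: "0 < \<delta>" "\<delta> < c / (K + 1)" and v: "c * (norm v)\<^sup>2 \<le> G v v" "G v e = 0"
      and nz: "v + x *\<^sub>R e \<noteq> 0"
    have "\<delta> * K < c"
    proof -
      have "\<delta> * (K + 1) < c" using \<delta> K by (simp add: pos_less_divide_eq)
      then show ?thesis using \<delta> by (simp add: algebra_simps)
    qed
    have "0 < (c - \<delta> * K) * (norm v)\<^sup>2 + \<delta> * (\<eta> / 2) * x\<^sup>2"
    proof (cases "v = 0")
      case True
      then have "x \<noteq> 0" using nz by auto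
      then show ?thesis using True \<delta> \<eta> by simp
    next
      case False
      then have "0 < (c - \<delta> * K) * (norm v)\<^sup>2" using \<open>\<delta> * K < c\<close> by simp
      moreover have "0 \<le> \<delta> * (\<eta> / 2) * x\<^sup>2" using \<delta> \<eta> by simp
      ultimately show ?thesis by linarith
    qed
    also have "\<dots> = c * (norm v)\<^sup>2 + \<delta> * (\<eta> / 2 * x\<^sup>2 - K * (norm v)\<^sup>2)"
      by (simp add: algebra_simps)
    also have "\<dots> \<le> G v v + \<delta> * H (v + x *\<^sub>R e) (v + x *\<^sub>R e)"
      using v \<delta> H_lower by (intro add_mono mult_left_mono) auto
    also have "G v v = G (v + x *\<^sub>R e) (v + x *\<^sub>R e)"
      by (simp add: symmetric_bilinear_quadratic[OF G] v e)
    finally show "0 < G (v + x *\<^sub>R e) (v + x *\<^sub>R e) + \<delta> * H (v + x *\<^sub>R e) (v + x *\<^sub>R e)" .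
  qed
qed

section \<open>The eigencurve and its derivative\<close>

context coercive_pencil
begin

lemma eigencurve_eq: "eigencurve a b m n lam = (LEAST t. eigenpoint a b m lam t \<and> n \<le> eigencount lam t)"
  by (simp add: eigencurve_def eigencount_def)

text \<open>
  Only finitely many eigenparameters are at most \<open>T\<close>, so once the count reaches \<open>n\<close> by \<open>T\<close>, the least
  eigenparameter at which it does so exists.
\<close>
lemma eigencurve_attained:
  assumes n: "1 \<le> n" "n \<le> eigencount lam T"
  shows "eigencurve a b m n lam \<le> T" "n \<le> eigencount lam (eigencurve a b m n lam)"
proof -
  define E where "E = {t. eigenpoint a b m lam t \<and> t \<le> T}"
  define E' where "E' = {t\<in>E. n \<le> eigencount lam t}"
  have "finite E"
    unfolding E_def by (rule spectral_decomposition[of lam T]) simp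
  have "E \<noteq> {}" using n unfolding eigencount_def E_def[symmetric] by auto
  have "{t. eigenpoint a b m lam t \<and> t \<le> Max E} = E"
    using Max_in[OF \<open>finite E\<close> \<open>E \<noteq> {}\<close>] Max_ge[OF \<open>finite E\<close>] by (force simp: E_def)
  then have "eigencount lam (Max E) = eigencount lam T"
    by (simp add: eigencount_def E_def)
  then have "Max E \<in> E'" using Max_in[OF \<open>finite E\<close> \<open>E \<noteq> {}\<close>] n by (simp add: E'_def)
  have fin: "finite E'" using \<open>finite E\<close> by (simp add: E'_def)
  have Min: "Min E' \<in> E'" using fin \<open>Max E \<in> E'\<close> by (intro Min_in) auto
  have "eigencurve a b m n lam = Min E'"
    unfolding eigencurve_eq
  proof (rule Least_equality)
    show "eigenpoint a b m lam (Min E') \<and> n \<le> eigencount lam (Min E')"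
      using Min by (simp add: E'_def E_def)
    fix t assume t: "eigenpoint a b m lam t \<and> n \<le> eigencount lam t"
    show "Min E' \<le> t"
    proof (cases "t \<le> T")
      case True
      then show ?thesis using t fin by (intro Min_le) (auto simp: E'_def E_def)
    next
      case False
      moreover have "Min E' \<le> T" using Min by (simp add: E'_def E_def)
      ultimately show ?thesis by linarith
    qed
  qed
  with Min show "eigencurve a b m n lam \<le> T" "n \<le> eigencount lam (eigencurve a b m n lam)"
    by (simp_all add: E'_def E_def)
qed

lemma eigencurve_gt:
  assumes "1 \<le> n" "n \<le> eigencount lam T" "eigencount lam s < n"
  shows "s < eigencurve a b m n lam"
proof (rule ccontr)
  assume "\<not> s < eigencurve a b m n lam"
  then have "eigencount lam (eigencurve a b m n lam) \<le> eigencount lam s" by (simp add: eigencount_mono)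
  with eigencurve_attained(2)[OF assms(1,2)] assms(3) show False by simp
qed

text \<open>
  As long as the count is below the dimension, some nonzero vector \<open>w\<close> is \<open>m\<close>-orthogonal to the
  eigenvectors found so far.  At every large enough parameter, \<open>Q\<close> is nonpositive on the span of
  \<open>w\<close> and these eigenvectors, so the count has grown.
\<close>
lemma eigencount_reaches_dimension:
  fixes B :: "'a set"
  assumes "independent B"
  shows "\<exists>T. card B \<le> eigencount lam T"
proof -
  have "\<exists>T. k \<le> eigencount lam T" if "k \<le> card B" for k
    using that
  proof (induction k)
    case (Suc k)
    then obtain T where T: "k \<le> eigencount lam T" by auto
    show ?case
    proof (cases "Suc k \<le> eigencount lam T")
      case False
      obtain F where F: "finite F" "eigenfamily lam T F" "card F = eigencount lam T"
        by (rule spectral_decomposition[of lam T])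
      then have "card F < card B" using False T Suc.prems by simp
      then obtain w where w: "w \<noteq> 0" "w \<in> perp F"
        by (rule span_meets_perp[OF F(1) eigenfamily_m_orthogonal[OF F(2)] assms])
      define S where "S = max T (rayleigh lam w)"
      have "card (insert w F) \<le> eigencount lam S"
      proof (rule eigencount_ge_if_nonpos_on_span)
        show "independent (insert w F)"
          using w F by (intro m_orthogonal_independent m_orthogonal_insert) (auto simp: eigenfamily_def)
        fix u assume "u \<in> span (insert w F)"
        then obtain k where k: "u - k *\<^sub>R w \<in> span F" by (auto simp: span_breakdown_eq)
        define p where "p = u - k *\<^sub>R w"
        have famS: "eigenfamily lam S F" using F(2) by (auto simp: eigenfamily_def S_def)
        have "Q lam S p p \<le> 0" using k by (intro eigenfamily_Q_span_nonpos[OF F(1) famS]) (simp add: p_def)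
        moreover have "Q lam S w w \<le> 0"
          using Q_antimono[of "rayleigh lam w" S lam w] m_pos[OF w(1)]
          by (simp add: Q_def rayleigh_def S_def)
        moreover have "Q lam S w p = 0"
        proof (rule symmetric_bilinear_span_eq_0[OF sym_Q])
          show "p \<in> span F" using k by (simp add: p_def)
          fix f assume "f \<in> F"
          then have "Q lam S f w = (rayleigh lam f - S) * m f w" "m w f = 0"
            using F(2) w(2) by (auto simp: eigenfamily_def perp_def intro: eigenvector_Q)
          then show "Q lam S w f = 0"
            using symmetric_bilinear_commute[OF sym_Q, of lam S w f] m_commute[of w f] by simp
        qed
        then have "Q lam S p w = 0" using symmetric_bilinear_commute[OF sym_Q, of lam S p w] by simp
        moreover have "Q lam S u u = Q lam S (p + k *\<^sub>R w) (p + k *\<^sub>R w)" by (simp add: p_def)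
        ultimately show "Q lam S u u \<le> 0"
          by (simp add: symmetric_bilinear_quadratic[OF sym_Q] add_nonpos_nonpos mult_nonneg_nonpos)
      qed
      moreover have "card (insert w F) = Suc (card F)"
        using perp_notin[OF w(2,1)] F(1) by simp
      ultimately have "Suc k \<le> eigencount lam S" using T F(3) by simp
      then show ?thesis by blast
    qed blast
  qed auto
  then show ?thesis by blast
qed

text \<open>
  A Garding inequality: every parameter below the minimum of the Rayleigh quotient on the whole space
  will do.  The nonzero \<open>v\<close> ensures that this minimum exists.
\<close>
lemma Q_globally_coercive:
  fixes v :: 'a
  assumes "v \<noteq> 0"
  obtains t c where "0 < c" "\<And>u. c * (norm u)\<^sup>2 \<le> Q lam t u u"
proof -
  have UNIV: "perp {} = UNIV" by (simp add: perp_def)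
  have v: "Q lam (rayleigh lam v) v v = 0" using m_pos[OF assms] by (simp add: Q_def rayleigh_def)
  obtain \<rho> where \<rho>: "\<And>u. 0 \<le> Q lam \<rho> u u"
    by (rule minimal_parameter_on_perp[of v "{}" lam "rayleigh lam v"])
      (auto simp: UNIV assms v intro: that)
  have pos: "0 < Q lam (\<rho> - 1) u u" if "u \<noteq> 0" for u
    using \<rho>[of u] m_pos[OF that] Q_shift[of lam "\<rho> - 1" u u \<rho>] by simp
  show ?thesis
    by (rule Q_coercive_on_perp[of "{}" lam "\<rho> - 1"]) (auto simp: UNIV intro: pos that)
qed

text \<open>
  On \<open>span F\<close> the form \<open>Q lam t\<close> lies below \<open>- (t - s) m w w\<close>, and the inequality of
  \<open>Q_globally_coercive\<close> bounds \<open>\<parallel>w\<parallel>\<^sup>2\<close> there by a multiple of \<open>m w w\<close>.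
\<close>
lemma Q_negative_on_span:
  fixes v :: 'a
  assumes F: "finite F" "eigenfamily lam s F" and "s < t" and "v \<noteq> 0"
  obtains c where "0 < c" "\<And>w. w \<in> span F \<Longrightarrow> Q lam t w w \<le> - (c * (norm w)\<^sup>2)"
proof -
  obtain t0 c where c: "0 < c" "\<And>u. c * (norm u)\<^sup>2 \<le> Q lam t0 u u"
    using Q_globally_coercive[OF \<open>v \<noteq> 0\<close>] by metis
  define K where "K = max 1 (s - t0)"
  have K: "0 < K" by (simp add: K_def)
  show ?thesis
  proof
    show "0 < (t - s) * (c / K)" using \<open>s < t\<close> c K by simp
    fix w assume "w \<in> span F"
    then have neg: "Q lam s w w \<le> 0" by (rule eigenfamily_Q_span_nonpos[OF F])
    have "c * (norm w)\<^sup>2 \<le> Q lam s w w + (s - t0) * m w w"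
      using c(2)[of w] by (simp add: Q_shift[of lam t0 w w s])
    also have "\<dots> \<le> 0 + K * m w w"
      using neg by (intro add_mono mult_right_mono m_nonneg) (simp_all add: K_def)
    finally have "c / K * (norm w)\<^sup>2 \<le> m w w" using K by (simp add: field_simps)
    then have "(t - s) * (c / K * (norm w)\<^sup>2) \<le> (t - s) * m w w"
      using \<open>s < t\<close> by (intro mult_left_mono) auto
    then show "Q lam t w w \<le> - ((t - s) * (c / K) * (norm w)\<^sup>2)"
      using neg Q_shift[of lam t w w s] by (simp add: algebra_simps)
  qed
qed

text \<open>
  At the simple eigenpoint, the space splits into a negative part spanned by \<open>n - 1\<close> eigenvectors, the
  line through \<open>e\<close>, and a positive part.  The count \<open>n - 1\<close> is exact: at the largest smaller
  eigenparameter the count has not reached \<open>n\<close>, because the \<open>n\<close>-th eigenparameter is \<open>mu0\<close>, and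
  \<open>mu0\<close> itself contributes just one.
\<close>
lemma simple_eigenpoint_splitting:
  assumes simple: "simple_eigenpoint a b m lam0 mu0" and e: "is_eigenvector a b m lam0 mu0 e"
    and n: "1 \<le> n" "n \<le> eigencount lam0 T" and eq: "eigencurve a b m n lam0 = mu0"
  obtains F c where "finite F" "m_orthogonal F" "card F = n - 1" "e \<in> perp F" "0 < c"
    "\<And>w. w \<in> span F \<Longrightarrow> Q lam0 mu0 w w \<le> - (c * (norm w)\<^sup>2)"
    "\<And>v. v \<in> perp (insert e F) \<Longrightarrow> c * (norm v)\<^sup>2 \<le> Q lam0 mu0 v v"
proof -
  obtain F c where F: "finite F" "eigenfamily lam0 mu0 F" "card F = eigencount lam0 mu0"
    and espace: "\<And>t. t \<le> mu0 \<Longrightarrow> eigenspace a b m lam0 t = span {f\<in>F. rayleigh lam0 f = t}"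
    and c: "0 < c" "\<And>u. u \<in> perp F \<Longrightarrow> c * (norm u)\<^sup>2 \<le> Q lam0 mu0 u u"
    by (rule spectral_decomposition[of lam0 mu0]) blast
  define G where "G = {f\<in>F. rayleigh lam0 f = mu0}"
  have "independent G"
    using F(2) by (intro m_orthogonal_independent) (auto simp: G_def eigenfamily_def intro: m_orthogonal_subset)
  then have "card G = 1"
    using simple espace[of mu0] by (simp add: simple_eigenpoint_def G_def dim_eq_card_independent)
  then obtain f where f: "G = {f}" by (auto simp: card_1_singleton_iff)
  have nz: "e \<noteq> 0" using e by (simp add: is_eigenvector_def)
  have "e \<in> span {f}"
    using e espace[of mu0] f by (auto simp: G_def eigenspace_def)
  then obtain k where k: "e = k *\<^sub>R f" by (auto simp: span_singleton)
  have "k \<noteq> 0" using nz k by auto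
  define F' where "F' = F - {f}"
  have "f \<in> F" using f by (auto simp: G_def)
  have F': "finite F'" "m_orthogonal F'" "F = insert f F'" "f \<notin> F'"
    using F \<open>f \<in> F\<close> by (auto simp: F'_def eigenfamily_def intro: m_orthogonal_subset)
  have "f \<in> perp F'"
    using F(2) \<open>f \<in> F\<close> by (auto simp: F'_def eigenfamily_def perp_def intro: m_orthogonalD)
  then have eperp: "e \<in> perp F'" unfolding k by (rule perp_scale)
  \<comment> \<open>A parameter below \<open>mu0\<close> that bounds the other members; \<open>mu0 - 1\<close> covers the case that there are none.\<close>
  define s where "s = Max (insert (mu0 - 1) (rayleigh lam0 ` F'))"
  have "rayleigh lam0 g < mu0" if "g \<in> F'" for g
  proof -
    have "rayleigh lam0 g \<noteq> mu0" using that f by (auto simp: F'_def G_def)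
    moreover have "rayleigh lam0 g \<le> mu0" using that F(2) by (auto simp: F'_def eigenfamily_def)
    ultimately show ?thesis by simp
  qed
  then have "s < mu0" using F'(1) by (simp add: s_def)
  have fam: "eigenfamily lam0 s F'"
    using F(2) F' by (auto simp: eigenfamily_def s_def intro!: Max_ge)
  have "card F' \<le> eigencount lam0 s"
    by (rule eigencount_ge_if_nonpos_on_span[OF eigenfamily_independent[OF fam]
          eigenfamily_Q_span_nonpos[OF F'(1) fam]])
  moreover have "\<not> n \<le> eigencount lam0 s"
    using eigencurve_attained(1)[OF n(1), of lam0 s] eq \<open>s < mu0\<close> by auto
  moreover have "n \<le> Suc (card F')"
    using eigencurve_attained(2)[OF n] eq F(3) F' by simp
  ultimately have card: "card F' = n - 1" by simp
  obtain c' where c': "0 < c'" "\<And>w. w \<in> span F' \<Longrightarrow> Q lam0 mu0 w w \<le> - (c' * (norm w)\<^sup>2)"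
    using Q_negative_on_span[OF F'(1) fam \<open>s < mu0\<close> nz] by metis
  show ?thesis
  proof
    show "finite F'" "m_orthogonal F'" "card F' = n - 1" "e \<in> perp F'" by fact+
    show "0 < min c c'" using c c' by simp
    show "Q lam0 mu0 w w \<le> - (min c c' * (norm w)\<^sup>2)" if "w \<in> span F'" for w
      using c'(2)[OF that] mult_right_mono[of "min c c'" c' "(norm w)\<^sup>2"] by simp
    fix v assume "v \<in> perp (insert e F')"
    then have "v \<in> perp F" using F'(3) k \<open>k \<noteq> 0\<close> by (simp add: perp_def m_simps)
    then show "min c c' * (norm v)\<^sup>2 \<le> Q lam0 mu0 v v"
      using c(2)[of v] mult_right_mono[of "min c c'" c "(norm v)\<^sup>2"] by simp
  qed
qed

text \<open>
  Moving to \<open>lam0 + \<sigma> \<delta>\<close> and to the line of slope \<open>d\<close>, raised or lowered by \<open>\<epsilon> \<delta>\<close>, perturbs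
  \<open>Q lam0 mu0\<close> by \<open>\<delta>\<close> times a bounded form.  The choice of \<open>d\<close> makes \<open>b + d m\<close> vanish at \<open>e\<close>, so
  the value of this form at \<open>e\<close> is \<open>\<epsilon> m e e\<close> up to sign.  On the raised line \<open>Q\<close> is
  therefore nonpositive on an \<open>n\<close>-dimensional space, and on the lowered line it is positive on a space
  of codimension \<open>n - 1\<close>; the curve passes between the two.
\<close>
lemma eigencurve_one_sided_estimate:
  assumes simple: "simple_eigenpoint a b m lam0 mu0" and e: "is_eigenvector a b m lam0 mu0 e"
    and n: "1 \<le> n" "n \<le> eigencount lam0 T" and eq: "eigencurve a b m n lam0 = mu0"
    and \<sigma>: "\<bar>\<sigma>\<bar> = 1" and \<epsilon>: "0 < \<epsilon>" and d: "d = - (b e e / m e e)"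
  obtains r where "0 < r" "\<And>\<delta>. 0 < \<delta> \<Longrightarrow> \<delta> < r \<Longrightarrow>
    \<bar>eigencurve a b m n (lam0 + \<sigma> * \<delta>) - mu0 - \<sigma> * \<delta> * d\<bar> \<le> \<epsilon> * \<delta>"
proof -
  obtain F c where F: "finite F" "m_orthogonal F" "card F = n - 1" "e \<in> perp F" and c: "0 < c"
    and neg: "\<And>w. w \<in> span F \<Longrightarrow> Q lam0 mu0 w w \<le> - (c * (norm w)\<^sup>2)"
    and pos: "\<And>v. v \<in> perp (insert e F) \<Longrightarrow> c * (norm v)\<^sup>2 \<le> Q lam0 mu0 v v"
    using simple_eigenpoint_splitting[OF simple e n eq] by blast
  have nz: "e \<noteq> 0" using e by (simp add: is_eigenvector_def)
  have Qe: "Q lam0 mu0 u e = 0" for u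
    using e symmetric_bilinear_commute[OF sym_Q, of lam0 mu0 u e] by (simp add: is_eigenvector_iff_Q)
  obtain Cb where Cb: "0 \<le> Cb" "\<And>u v. \<bar>b u v\<bar> \<le> Cb * norm u * norm v"
    using weakly_continuous_imp_bounded[OF sym_b wc_b] by blast
  obtain Cm where Cm: "0 \<le> Cm" "\<And>u v. \<bar>m u v\<bar> \<le> Cm * norm u * norm v"
    using weakly_continuous_imp_bounded[OF sym_m wc_m] by blast
  \<comment> \<open>The perturbation at the raised line is \<open>- \<delta> H \<sigma>\<close>, at the lowered line \<open>\<delta> H (- \<sigma>)\<close>.\<close>
  define H where "H \<tau> u v = \<tau> * b u v + (\<tau> * d + \<epsilon>) * m u v" for \<tau> u v
  define C where "C = Cb + (\<bar>d\<bar> + \<epsilon>) * Cm"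
  have H: "symmetric_bilinear (H \<tau>)" for \<tau>
    using symmetric_bilinear_add[OF symmetric_bilinear_scale[OF sym_b] sym_m, of \<tau> "\<tau> * d + \<epsilon>"]
    by (simp add: H_def[abs_def])
  have C: "0 \<le> C" using Cb Cm \<epsilon> by (simp add: C_def)
  have HC: "\<bar>H \<tau> u v\<bar> \<le> C * norm u * norm v" if "\<bar>\<tau>\<bar> = 1" for \<tau> u v
  proof -
    have "\<bar>H \<tau> u v\<bar> \<le> \<bar>\<tau> * b u v\<bar> + \<bar>(\<tau> * d + \<epsilon>) * m u v\<bar>" unfolding H_def by (rule abs_triangle_ineq)
    also have "\<bar>\<tau> * b u v\<bar> \<le> Cb * norm u * norm v" using that Cb(2) by (simp add: abs_mult)
    also have "\<bar>(\<tau> * d + \<epsilon>) * m u v\<bar> \<le> (\<bar>d\<bar> + \<epsilon>) * (Cm * norm u * norm v)"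
      unfolding abs_mult
    proof (intro mult_mono Cm)
      show "\<bar>\<tau> * d + \<epsilon>\<bar> \<le> \<bar>d\<bar> + \<epsilon>" using that \<epsilon> abs_triangle_ineq[of "\<tau> * d" \<epsilon>] by (simp add: abs_mult)
    qed (use \<epsilon> in auto)
    finally show ?thesis by (simp add: C_def algebra_simps)
  qed
  have He: "0 < H \<tau> e e" for \<tau>
    using m_pos[OF nz] \<epsilon> by (simp add: H_def d field_simps)
  have \<sigma>': "\<bar>- \<sigma>\<bar> = 1" using \<sigma> by simp
  have symN: "symmetric_bilinear (\<lambda>u v. - 1 * Q lam0 mu0 u v)"
    by (rule symmetric_bilinear_scale[OF sym_Q])
  obtain r1 where r1: "0 < r1" "\<And>\<delta> v x. 0 < \<delta> \<Longrightarrow> \<delta> < r1 \<Longrightarrow> c * (norm v)\<^sup>2 \<le> - 1 * Q lam0 mu0 v v \<Longrightarrow>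
      - 1 * Q lam0 mu0 v e = 0 \<Longrightarrow> v + x *\<^sub>R e \<noteq> 0 \<Longrightarrow>
      0 < - 1 * Q lam0 mu0 (v + x *\<^sub>R e) (v + x *\<^sub>R e) + \<delta> * H \<sigma> (v + x *\<^sub>R e) (v + x *\<^sub>R e)"
    by (rule perturbed_form_positive[OF symN H[of \<sigma>] C HC[OF \<sigma>] c _ He]) (simp add: Qe, rule that)
  obtain r2 where r2: "0 < r2" "\<And>\<delta> v x. 0 < \<delta> \<Longrightarrow> \<delta> < r2 \<Longrightarrow> c * (norm v)\<^sup>2 \<le> Q lam0 mu0 v v \<Longrightarrow>
      Q lam0 mu0 v e = 0 \<Longrightarrow> v + x *\<^sub>R e \<noteq> 0 \<Longrightarrow>
      0 < Q lam0 mu0 (v + x *\<^sub>R e) (v + x *\<^sub>R e) + \<delta> * H (- \<sigma>) (v + x *\<^sub>R e) (v + x *\<^sub>R e)"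
    by (rule perturbed_form_positive[OF sym_Q H C HC[OF \<sigma>'] c Qe He]) (rule that)
  show ?thesis
  proof
    show "0 < min r1 r2" using r1 r2 by simp
    fix \<delta> :: real assume \<delta>: "0 < \<delta>" "\<delta> < min r1 r2"
    define lam where "lam = lam0 + \<sigma> * \<delta>"
    define hi where "hi = mu0 + \<sigma> * \<delta> * d + \<epsilon> * \<delta>"
    define lo where "lo = mu0 + \<sigma> * \<delta> * d - \<epsilon> * \<delta>"
    have Qhi: "Q lam hi u u = - (- 1 * Q lam0 mu0 u u + \<delta> * H \<sigma> u u)" for u
      by (simp add: Q_def lam_def hi_def H_def algebra_simps)
    have Qlo: "Q lam lo u u = Q lam0 mu0 u u + \<delta> * H (- \<sigma>) u u" for u
      by (simp add: Q_def lam_def lo_def H_def algebra_simps)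
    have "n = card (insert e F)"
      using F n perp_notin[OF F(4) nz] by simp
    also have "\<dots> \<le> eigencount lam hi"
    proof (rule eigencount_ge_if_nonpos_on_span)
      show "independent (insert e F)"
        using F nz by (intro m_orthogonal_independent m_orthogonal_insert)
      fix u assume "u \<in> span (insert e F)"
      then obtain x where x: "u - x *\<^sub>R e \<in> span F" by (auto simp: span_breakdown_eq)
      show "Q lam hi u u \<le> 0"
      proof (cases "u = 0")
        case False
        then show ?thesis
          using r1(2)[of \<delta> "u - x *\<^sub>R e" x] \<delta> neg[OF x] Qe by (simp add: Qhi)
      qed (simp add: Q_simps)
    qed
    finally have hi: "n \<le> eigencount lam hi" .
    have "eigencount lam lo \<le> card F"
    proof (rule eigencount_le_if_pos_on_perp[OF F(1,2)])
      fix u assume u: "u \<in> perp F" "u \<noteq> 0"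
      define x where "x = m u e / m e e"
      have "u - x *\<^sub>R e \<in> perp (insert e F)"
        using u F(4) m_pos[OF nz] by (auto simp: perp_def m_simps x_def)
      from pos[OF this] show "0 < Q lam lo u u"
        using r2(2)[of \<delta> "u - x *\<^sub>R e" x] \<delta> u Qe by (simp add: Qlo)
    qed
    then have "eigencount lam lo < n" using F n by simp
    with hi n have "eigencurve a b m n lam \<le> hi" "lo < eigencurve a b m n lam"
      by (auto intro: eigencurve_attained eigencurve_gt)
    then show "\<bar>eigencurve a b m n (lam0 + \<sigma> * \<delta>) - mu0 - \<sigma> * \<delta> * d\<bar> \<le> \<epsilon> * \<delta>"
      by (simp add: lam_def hi_def lo_def abs_le_iff)
  qed
qed

lemma eigencurve_derivative:
  assumes simple: "simple_eigenpoint a b m lam0 mu0" and e: "is_eigenvector a b m lam0 mu0 e"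
    and n: "1 \<le> n" "n \<le> eigencount lam0 T" and eq: "eigencurve a b m n lam0 = mu0"
  shows "(eigencurve a b m n has_real_derivative - (b e e / m e e)) (at lam0)"
proof -
  define d where "d = - (b e e / m e e)"
  define g where "g = eigencurve a b m n"
  have "(\<lambda>h. (g (lam0 + h) - g lam0) / h) \<midarrow>0\<rightarrow> d"
  proof (rule LIM_I)
    fix \<epsilon> :: real assume "0 < \<epsilon>"
    then have half: "0 < \<epsilon> / 2" by simp
    note estimate = eigencurve_one_sided_estimate[OF simple e n eq _ half d_def, folded g_def]
    obtain r1 where r1: "0 < r1"
      "\<And>\<delta>. 0 < \<delta> \<Longrightarrow> \<delta> < r1 \<Longrightarrow> \<bar>g (lam0 + 1 * \<delta>) - mu0 - 1 * \<delta> * d\<bar> \<le> \<epsilon> / 2 * \<delta>"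
      by (rule estimate[of 1]) auto
    obtain r2 where r2: "0 < r2"
      "\<And>\<delta>. 0 < \<delta> \<Longrightarrow> \<delta> < r2 \<Longrightarrow> \<bar>g (lam0 + - 1 * \<delta>) - mu0 - - 1 * \<delta> * d\<bar> \<le> \<epsilon> / 2 * \<delta>"
      by (rule estimate[of "- 1"]) auto
    have "norm ((g (lam0 + h) - g lam0) / h - d) < \<epsilon>" if h: "h \<noteq> 0" "norm (h - 0) < min r1 r2" for h
    proof -
      have "\<bar>g (lam0 + h) - mu0 - h * d\<bar> \<le> \<epsilon> / 2 * \<bar>h\<bar>"
      proof (cases "0 < h")
        case True
        then show ?thesis using r1(2)[of h] h by simp
      next
        case False
        then show ?thesis using r2(2)[of "- h"] h by simp
      qed
      also have "\<dots> < \<epsilon> * \<bar>h\<bar>" using \<open>0 < \<epsilon>\<close> h by simp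
      finally have "\<bar>g (lam0 + h) - mu0 - h * d\<bar> / \<bar>h\<bar> < \<epsilon>" using h by (simp add: pos_divide_less_eq)
      moreover have "(g (lam0 + h) - g lam0) / h - d = (g (lam0 + h) - mu0 - h * d) / h"
        using h eq by (simp add: g_def diff_divide_distrib)
      ultimately show ?thesis by (simp add: abs_divide)
    qed
    moreover have "0 < min r1 r2" using r1 r2 by simp
    ultimately show "\<exists>s>0. \<forall>h. h \<noteq> 0 \<and> norm (h - 0) < s \<longrightarrow>
        norm ((g (lam0 + h) - g lam0) / h - d) < \<epsilon>" by blast
  qed
  then show ?thesis by (simp add: DERIV_def g_def d_def)
qed

end

lemma independent_set_of_card:
  assumes "(\<exists>B::'a::real_vector set. finite B \<and> span B = UNIV) \<longrightarrow> n \<le> dim (UNIV :: 'a::real_vector set)"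
  obtains B :: "'a::real_vector set" where "independent B" "card B = n"
proof -
  obtain B :: "'a set" where B: "independent B" "UNIV \<subseteq> span B" "card B = dim (UNIV :: 'a set)"
    using basis_exists[of UNIV] by metis
  obtain B' where "B' \<subseteq> B" "card B' = n"
  proof (cases "finite B")
    case True
    then have "n \<le> card B" using assms B by (metis top.extremum_uniqueI)
    then show ?thesis using that obtain_subset_with_card_n by metis
  next
    case False
    then show ?thesis using that infinite_arbitrarily_large by metis
  qed
  with that[OF independent_mono[OF B(1)]] show ?thesis by blast
qed

theorem corollary6p3:
  fixes a b m :: "'a::{real_inner, complete_space} \<Rightarrow> 'a \<Rightarrow> real"
    and lam0 mu0 :: real and e :: 'a and n :: nat
  assumes separable: "separable_space (euclidean :: 'a topology)"
    and a: "symmetric_bilinear a" "continuous_coercive a"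
    and b: "symmetric_bilinear b" "weakly_continuous b"
    and m: "symmetric_bilinear m" "weakly_continuous m" "\<And>u. u \<noteq> 0 \<Longrightarrow> m u u > 0"
    and simple: "simple_eigenpoint a b m lam0 mu0"
    and e: "is_eigenvector a b m lam0 mu0 e"
    and n: "n \<ge> 1" "(\<exists>B::'a set. finite B \<and> span B = UNIV) \<longrightarrow> n \<le> dim (UNIV :: 'a set)"
    and eq: "eigencurve a b m n lam0 = mu0"
  shows "((\<lambda>lam. eigencurve a b m n lam) has_real_derivative - (b e e / m e e)) (at lam0)"
proof -
  interpret coercive_pencil a b m
    by unfold_locales (fact separable a b m)+
  obtain B :: "'a set" where B: "independent B" "card B = n"
    using independent_set_of_card[OF n(2)] .
  obtain T where "n \<le> eigencount lam0 T"
    using eigencount_reaches_dimension[OF B(1)] B(2) by auto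
  from eigencurve_derivative[OF simple e n(1) this eq] show ?thesis .
qed

end
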